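(* Let $\lambda$ and $\mu$ be partitions such that $\frac{\lambda+\mu}{2}$ is again a partition (i.e. $\lambda_i+\mu_i$ is even for all $i$). Then for every integer $d \geq \max\{|\lambda|+\lambda_1,\ |\mu|+\mu_1\}$, $$\left(\dim V_{\frac{\lambda+\mu}{2}[d]}\right)^{2} \geq \dim V_{\lambda[d]} \cdot \dim V_{\mu[d]}.$$ Equivalently, $$\left(f^{\frac{\lambda+\mu}{2}[d]}\right)^{2} \geq f^{\lambda[d]} \cdot f^{\mu[d]}.$$
   Context: A partition $\lambda=(\lambda_1\ge\lambda_2\ge\cdots\ge 0)$ is a weakly decreasing sequence of nonnegative integers with finitely many nonzero terms; $|\lambda|=\sum_i\lambda_i$. Sums and halves are taken componentwise: $\frac{\lambda+\mu}{2}=\left(\frac{\lambda_1+\mu_1}{2},\frac{\lambda_2+\mu_2}{2},\dots\right)$. For a partition $\lambda$ and an integer $d\ge|\lambda|+\lambda_1$, the padded partition is $\lambda[d]=(d-|\lambda|,\lambda_1,\lambda_2,\dots)$, a partition of $d$; the notation $\frac{\lambda+\mu}{2}[d]$ means $\left(\frac{\lambda+\mu}{2}\right)[d]$. For a partition $\alpha$ of $d$, $V_\alpha$ denotes the irreducible complex representation of the symmetric group $S_d$ indexed by $\alpha$, and $f^\alpha$ denotes the number of standard Young tableaux of shape $\alpha$. *)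

theory Defs
  imports Complex_Main "HOL-Library.FuncSet" "HOL-Library.Function_Algebras"
    "HOL-Combinatorics.Permutations"
begin

text \<open>Partitions are infinite sequences indexed from 0: the part written
  \<open>\<lambda>\<^sub>1\<close> in the usual notation is \<open>\<lambda> 0\<close> here.\<close>

definition is_partition :: "(nat \<Rightarrow> nat) \<Rightarrow> bool" where
  "is_partition \<alpha> \<longleftrightarrow> antimono \<alpha> \<and> finite {i. \<alpha> i \<noteq> 0}"

definition weight :: "(nat \<Rightarrow> nat) \<Rightarrow> nat" where
  "weight \<alpha> = (\<Sum>i | \<alpha> i \<noteq> 0. \<alpha> i)"

text \<open>The padded partition \<open>\<lambda>[d]\<close>. The subtraction does not truncate, and the
  result is a partition of \<open>d\<close>, when \<open>d \<ge> |\<lambda>| + \<lambda>\<^sub>1\<close>.\<close>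

definition padded :: "(nat \<Rightarrow> nat) \<Rightarrow> nat \<Rightarrow> (nat \<Rightarrow> nat)" where
  "padded \<alpha> d = (\<lambda>i. case i of 0 \<Rightarrow> d - weight \<alpha> | Suc j \<Rightarrow> \<alpha> j)"

text \<open>Only used when all \<open>\<alpha> i + \<beta> i\<close> are even, so that \<open>div\<close> is exact.\<close>

definition half_sum :: "(nat \<Rightarrow> nat) \<Rightarrow> (nat \<Rightarrow> nat) \<Rightarrow> (nat \<Rightarrow> nat)" where
  "half_sum \<alpha> \<beta> = (\<lambda>i. (\<alpha> i + \<beta> i) div 2)"

text \<open>A cell is a pair (row, column). Tableaux are extensional functions, so that
  there are finitely many of them and each is counted once.\<close>

definition diagram :: "(nat \<Rightarrow> nat) \<Rightarrow> (nat \<times> nat) set" where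
  "diagram \<alpha> = {(i, j). j < \<alpha> i}"

definition tableaux :: "(nat \<Rightarrow> nat) \<Rightarrow> (nat \<times> nat \<Rightarrow> nat) set" where
  "tableaux \<alpha> = {T \<in> extensional (diagram \<alpha>). bij_betw T (diagram \<alpha>) {1..weight \<alpha>}}"

definition standard_tableaux :: "(nat \<Rightarrow> nat) \<Rightarrow> (nat \<times> nat \<Rightarrow> nat) set" where
  "standard_tableaux \<alpha> = {T \<in> tableaux \<alpha>.
     (\<forall>i j j'. j < j' \<and> (i, j') \<in> diagram \<alpha> \<longrightarrow> T (i, j) < T (i, j')) \<and>
     (\<forall>i i' j. i < i' \<and> (i', j) \<in> diagram \<alpha> \<longrightarrow> T (i, j) < T (i', j))}"

definition num_SYT :: "(nat \<Rightarrow> nat) \<Rightarrow> nat" where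
  "num_SYT \<alpha> = card (standard_tableaux \<alpha>)"

text \<open>The irreducible complex representation \<open>V\<^sub>\<alpha>\<close> of the symmetric group on
  \<open>{1..d}\<close>, for a partition \<open>\<alpha>\<close> of \<open>d\<close>, is realised as the Specht module: the span
  of the polytabloids inside the permutation module on the tabloids of shape \<open>\<alpha>\<close>
  (so that the one-row shape gives the trivial representation). The symmetric group
  acts on tableaux by permuting entries; the induced linear action maps the polytabloid
  of \<open>T\<close> to that of \<open>\<sigma> \<cdot> T\<close>, hence preserves the span.\<close>

definition perm_tableau ::
  "(nat \<Rightarrow> nat) \<Rightarrow> (nat \<Rightarrow> nat) \<Rightarrow> (nat \<times> nat \<Rightarrow> nat) \<Rightarrow> (nat \<times> nat \<Rightarrow> nat)" where
  "perm_tableau \<alpha> \<sigma> T = restrict (\<sigma> \<circ> T) (diagram \<alpha>)"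

definition row_entries :: "(nat \<Rightarrow> nat) \<Rightarrow> (nat \<times> nat \<Rightarrow> nat) \<Rightarrow> nat \<Rightarrow> nat set" where
  "row_entries \<alpha> T i = {T (i, j) | j. (i, j) \<in> diagram \<alpha>}"

definition column_entries :: "(nat \<Rightarrow> nat) \<Rightarrow> (nat \<times> nat \<Rightarrow> nat) \<Rightarrow> nat \<Rightarrow> nat set" where
  "column_entries \<alpha> T j = {T (i, j) | i. (i, j) \<in> diagram \<alpha>}"

definition tabloid ::
  "(nat \<Rightarrow> nat) \<Rightarrow> (nat \<times> nat \<Rightarrow> nat) \<Rightarrow> (nat \<times> nat \<Rightarrow> nat) set" where
  "tabloid \<alpha> T = {T' \<in> tableaux \<alpha>. \<forall>i. row_entries \<alpha> T' i = row_entries \<alpha> T i}"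

definition column_stabilizer ::
  "(nat \<Rightarrow> nat) \<Rightarrow> (nat \<times> nat \<Rightarrow> nat) \<Rightarrow> (nat \<Rightarrow> nat) set" where
  "column_stabilizer \<alpha> T = {\<sigma>. \<sigma> permutes {1..weight \<alpha>} \<and>
     (\<forall>j. \<sigma> ` column_entries \<alpha> T j = column_entries \<alpha> T j)}"

text \<open>A vector of the permutation module is given by its coefficients on tabloids.\<close>

definition polytabloid ::
  "(nat \<Rightarrow> nat) \<Rightarrow> (nat \<times> nat \<Rightarrow> nat) \<Rightarrow> ((nat \<times> nat \<Rightarrow> nat) set \<Rightarrow> complex)" where
  "polytabloid \<alpha> T = (\<lambda>X. \<Sum>\<sigma>\<in>column_stabilizer \<alpha> T.
     of_int (sign \<sigma>) * of_bool (X = tabloid \<alpha> (perm_tableau \<alpha> \<sigma> T)))"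

global_interpretation complex_fun: vector_space
  "\<lambda>(c::complex) (f::'a \<Rightarrow> complex) x. c * f x"
  by standard (auto simp: fun_eq_iff algebra_simps)

definition specht_module ::
  "(nat \<Rightarrow> nat) \<Rightarrow> ((nat \<times> nat \<Rightarrow> nat) set \<Rightarrow> complex) set" where
  "specht_module \<alpha> = complex_fun.span (polytabloid \<alpha> ` tableaux \<alpha>)"

definition dim_V :: "(nat \<Rightarrow> nat) \<Rightarrow> nat" where
  "dim_V \<alpha> = complex_fun.dim (specht_module \<alpha>)"

end

theory Submission
  imports Defs
begin

text \<open>Put \<open>l\<^sub>i = \<alpha>\<^sub>i + n - i\<close>. By the Frobenius formula the number of standard tableaux of
  shape \<open>\<alpha>\<close> is \<open>d! \<cdot> \<Prod>\<^sub>i\<^sub><\<^sub>j (l\<^sub>i - l\<^sub>j) / \<Prod>\<^sub>i l\<^sub>i!\<close>. Since \<open>l\<close> is affine in \<open>\<alpha>\<close>, the inequality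
  at a midpoint of two partitions of \<open>d\<close> holds factor by factor: AM-GM for the differences and
  log-convexity for the factorials. Padding commutes with midpoints. The Frobenius formula follows
  from the recursion on removable corners and the identity
  \<open>\<Sum>\<^sub>i x\<^sub>i \<Delta>(x - e\<^sub>i) = (\<Sum>\<^sub>i x\<^sub>i - n(n-1)/2) \<Delta>(x)\<close> for the Vandermonde product.

  The dimension of the Specht module equals this number because the standard polytabloids form
  a basis: they are unitriangular with respect to a potential on tabloids, and the Garnir relations
  express every other polytabloid through ones with a larger potential.\<close>

subsection \<open>A Vandermonde identity\<close>

text \<open>All three padded shapes have size \<open>d\<close>, so the factor \<open>d!\<close> is
  common and only the differences and the factorials compete; both inequalities help because the
  factorials stand in the denominator. One number \<open>n\<close> of rows must serve all three
  shapes, as \<open>shifted n\<close> is affine in the shape only for fixed \<open>n\<close>. The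
  corner recursion sums over removable corners alone, the Vandermonde identity over every row; they
  agree because rows without a corner contribute 0. For the Specht module, the usual dominance order
  on tabloids is replaced by numerical weights on cells. The row weight \<open>fst\<close> picks out
  a leading tabloid of each standard polytabloid, but it does not control Garnir relations, which
  move entries between columns. Those are controlled by the column weight \<open>snd\<close>, which
  column permutations leave alone, so straightening terminates for the lexicographic pair.\<close>

text \<open>This is the partial fraction expansion in \<open>y\<close>: the product tends to 1 at
  infinity and has a simple pole at each \<open>x i\<close>, with residue minus the product of the
  remaining factors at \<open>y = x i\<close>.\<close>

lemma partial_fractions_shift:
  fixes x :: "'i \<Rightarrow> real"
  assumes "finite I" "inj_on x I" "y \<notin> x ` I"
  shows "(\<Prod>j\<in>I. 1 - 1 / (y - x j))
       = 1 - (\<Sum>i\<in>I. (\<Prod>j\<in>I - {i}. 1 - 1 / (x i - x j)) / (y - x i))"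
  using assms
proof (induction I arbitrary: y rule: finite_induct)
  case empty
  then show ?case by simp
next
  case (insert k I)
  define A where "A i = (\<Prod>j\<in>I - {i}. 1 - 1 / (x i - x j))" for i
  have inj: "inj_on x I" and xk: "x k \<notin> x ` I" and y: "y \<notin> x ` I" and yk: "y \<noteq> x k"
    using insert.prems insert.hyps by auto
  have split: "(\<Prod>j\<in>insert k I - {i}. 1 - 1 / (x i - x j)) = A i * (1 - 1 / (x i - x k))"
    if "i \<in> I" for i
  proof -
    have "insert k I - {i} = insert k (I - {i})" using that insert.hyps by auto
    then show ?thesis using insert.hyps by (simp add: A_def)
  qed
  \<comment> \<open>The induction hypothesis at the point \<open>x k\<close> evaluates the
    coefficient of the new pole.\<close>
  have Ak: "(\<Prod>j\<in>insert k I - {k}. 1 - 1 / (x k - x j)) = 1 - (\<Sum>i\<in>I. A i / (x k - x i))"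
    using insert.IH[OF inj xk] insert.hyps by (simp add: A_def)
  have pf: "A i / (y - x i) * (1 - 1 / (y - x k))
      = A i * (1 - 1 / (x i - x k)) / (y - x i) - A i / (x k - x i) / (y - x k)" if "i \<in> I" for i
  proof -
    have "y - x i \<noteq> 0" "x i - x k \<noteq> 0" "x k - x i \<noteq> 0" "y - x k \<noteq> 0"
      using that y yk xk by (metis imageI right_minus_eq)+
    then show ?thesis by (simp add: divide_simps) (simp add: algebra_simps)
  qed
  have "(\<Prod>j\<in>insert k I. 1 - 1 / (y - x j))
      = (1 - (\<Sum>i\<in>I. A i / (y - x i))) * (1 - 1 / (y - x k))"
    using insert.IH[OF inj y] insert.hyps by (simp add: A_def mult.commute)
  also have "\<dots> = 1 - 1 / (y - x k) - (\<Sum>i\<in>I. A i / (y - x i) * (1 - 1 / (y - x k)))"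
    by (simp only: left_diff_distrib mult_1 sum_distrib_right)
  also have "\<dots> = 1 - 1 / (y - x k) - (\<Sum>i\<in>I. A i * (1 - 1 / (x i - x k)) / (y - x i))
      + (\<Sum>i\<in>I. A i / (x k - x i)) / (y - x k)"
    using pf by (simp add: sum_subtractf sum_divide_distrib)
  also have "\<dots> = 1 - (\<Sum>i\<in>insert k I. (\<Prod>j\<in>insert k I - {i}. 1 - 1 / (x i - x j)) / (y - x i))"
    unfolding sum.insert[OF insert.hyps] Ak using split by (simp add: diff_divide_distrib)
  finally show ?case .
qed

text \<open>Both identities compare coefficients, of \<open>1/y\<close> and of \<open>1/y^2\<close>,
  in the expansion of \<open>partial_fractions_shift\<close> at infinity. The induction avoids
  limits: it needs that expansion only at \<open>y = x k\<close>, and the second identity draws on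
  the first for the smaller set.\<close>

lemma sum_prod_shift:
  fixes x :: "'i \<Rightarrow> real"
  assumes "finite I" "inj_on x I"
  shows "(\<Sum>i\<in>I. \<Prod>j\<in>I - {i}. 1 - 1 / (x i - x j)) = real (card I)"
    and "(\<Sum>i\<in>I. x i * (\<Prod>j\<in>I - {i}. 1 - 1 / (x i - x j)))
       = (\<Sum>i\<in>I. x i) - real (card I choose 2)"
  using assms
proof (induction I rule: finite_induct)
  case empty
  {
    case 1 then show ?case by simp
  next
    case 2 then show ?case by (simp add: binomial_eq_0)
  }
next
  case (insert k I)
  define A where "A i = (\<Prod>j\<in>I - {i}. 1 - 1 / (x i - x j))" for i
  assume "inj_on x (insert k I)"
  then have inj: "inj_on x I" and xk: "x k \<notin> x ` I"
    using insert.hyps by auto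
  have split: "(\<Prod>j\<in>insert k I - {i}. 1 - 1 / (x i - x j)) = A i + A i / (x k - x i)"
    if "i \<in> I" for i
  proof -
    have "insert k I - {i} = insert k (I - {i})" using that insert.hyps by auto
    moreover have "x i \<noteq> x k" using xk that by (metis imageI)
    ultimately show ?thesis using insert.hyps
      by (simp add: A_def divide_simps) (simp add: algebra_simps)
  qed
  have Ak: "(\<Prod>j\<in>insert k I - {k}. 1 - 1 / (x k - x j)) = 1 - (\<Sum>i\<in>I. A i / (x k - x i))"
    using partial_fractions_shift[OF insert.hyps(1) inj xk] insert.hyps by (simp add: A_def)
  have S0: "(\<Sum>i\<in>I. A i) = real (card I)"
    using insert.IH(1)[OF inj] by (simp add: A_def)
  have S1: "(\<Sum>i\<in>I. x i * A i) = (\<Sum>i\<in>I. x i) - real (card I choose 2)"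
    using insert.IH(2)[OF inj] by (simp add: A_def)
  {
    case 1
    show ?case
      unfolding sum.insert[OF insert.hyps] Ak using split S0 insert.hyps by (simp add: sum.distrib)
  next
    case 2
    \<comment> \<open>Writing \<open>x i\<close> as \<open>x k - (x k - x i)\<close> over the new
      denominator separates a plain \<open>A i\<close> from a term that cancels against the
      contribution of \<open>k\<close>.\<close>
    have "x i * (A i + A i / (x k - x i)) = x i * A i - A i + x k * (A i / (x k - x i))"
      if "i \<in> I" for i
    proof -
      have "x k - x i \<noteq> 0" using xk that by (metis imageI right_minus_eq)
      then show ?thesis by (simp add: divide_simps) (simp add: algebra_simps)
    qed
    then have "(\<Sum>i\<in>I. x i * (\<Prod>j\<in>insert k I - {i}. 1 - 1 / (x i - x j)))
      = (\<Sum>i\<in>I. x i * A i) - (\<Sum>i\<in>I. A i) + x k * (\<Sum>i\<in>I. A i / (x k - x i))"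
      using split by (simp add: sum.distrib sum_subtractf sum_distrib_left)
    moreover have "real (card (insert k I) choose 2) = real (card I choose 2) + real (card I)"
      using insert.hyps by (simp add: numeral_2_eq_2)
    ultimately show ?case
      unfolding sum.insert[OF insert.hyps] Ak using S0 S1 by (simp add: algebra_simps)
  }
qed

text \<open>The factors are oriented so that the product is positive on strictly decreasing
  sequences, such as the \<open>shifted\<close> sequence of a partition.\<close>

definition vandermonde :: "nat \<Rightarrow> (nat \<Rightarrow> real) \<Rightarrow> real" where
  "vandermonde n x = (\<Prod>b<n. \<Prod>a<b. x a - x b)"

text \<open>Only factors containing \<open>x i\<close> change, and each acquires the ratio
  \<open>1 - 1 / (x i - x j)\<close>, whichever of the two indices comes first.\<close>

lemma vandermonde_shift:
  assumes "i < n" "inj_on x {..<n}"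
  shows "vandermonde n (x(i := x i - 1))
       = vandermonde n x * (\<Prod>j\<in>{..<n} - {i}. 1 - 1 / (x i - x j))"
  using assms
proof (induction n)
  case 0
  then show ?case by simp
next
  case (Suc n)
  have step: "vandermonde (Suc n) z = vandermonde n z * (\<Prod>a<n. z a - z n)" for z
    by (simp add: vandermonde_def)
  show ?case
  proof (cases "i = n")
    case True
    have "vandermonde n (x(n := x n - 1)) = vandermonde n x"
      by (simp add: vandermonde_def)
    moreover have "x a - (x n - 1) = (x a - x n) * (1 - 1 / (x n - x a))" if "a < n" for a
    proof -
      have "x n - x a \<noteq> 0" using inj_onD[OF Suc.prems(2), of n a] that by auto
      then show ?thesis by (simp add: divide_simps) (simp add: algebra_simps)
    qed
    moreover have "{..<Suc n} - {n} = {..<n}" by auto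
    ultimately show ?thesis unfolding step True by (simp add: prod.distrib)
  next
    case False
    then have i: "i < n" using Suc.prems by simp
    let ?y = "x(i := x i - 1)"
    have IH: "vandermonde n ?y = vandermonde n x * (\<Prod>j\<in>{..<n} - {i}. 1 - 1 / (x i - x j))"
      by (rule Suc.IH[OF i inj_on_subset[OF Suc.prems(2)]]) auto
    have "x i - x n \<noteq> 0" using Suc.prems(2) i by (auto simp: inj_on_def)
    then have "?y i - ?y n = (x i - x n) * (1 - 1 / (x i - x n))"
      using i by (simp add: divide_simps)
    moreover have "(\<Prod>a\<in>{..<n} - {i}. ?y a - ?y n) = (\<Prod>a\<in>{..<n} - {i}. x a - x n)"
      using i by (intro prod.cong) auto
    ultimately have "(\<Prod>a<n. ?y a - ?y n) = (\<Prod>a<n. x a - x n) * (1 - 1 / (x i - x n))"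
      using i by (simp add: prod.remove[of "{..<n}" i])
    moreover have "{..<Suc n} - {i} = insert n ({..<n} - {i})" using i by auto
    ultimately show ?thesis unfolding step IH by simp
  qed
qed

lemma sum_vandermonde_shift:
  assumes "inj_on x {..<n}"
  shows "(\<Sum>i<n. x i * vandermonde n (x(i := x i - 1)))
       = ((\<Sum>i<n. x i) - real (n choose 2)) * vandermonde n x"
proof -
  have "(\<Sum>i<n. x i * vandermonde n (x(i := x i - 1)))
      = (\<Sum>i<n. x i * (\<Prod>j\<in>{..<n} - {i}. 1 - 1 / (x i - x j))) * vandermonde n x"
    unfolding sum_distrib_right
    by (intro sum.cong) (use assms in \<open>auto simp: vandermonde_shift\<close>)
  then show ?thesis using sum_prod_shift(2)[of "{..<n}" x] assms by simp
qed

lemma vandermonde_eq_0: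
  assumes "a < b" "b < n" "x a = x b"
  shows "vandermonde n x = 0"
  using assms unfolding vandermonde_def by (auto intro!: prod_zero)

subsection \<open>Standard tableaux and the Frobenius formula\<close>

lemma diagram_Sigma: "diagram \<alpha> = Sigma {i. \<alpha> i \<noteq> 0} (\<lambda>i. {..<\<alpha> i})"
  by (auto simp: diagram_def)

lemma diagram_finite: "is_partition \<alpha> \<Longrightarrow> finite (diagram \<alpha>)"
  by (simp add: diagram_Sigma is_partition_def)

lemma card_diagram: "is_partition \<alpha> \<Longrightarrow> card (diagram \<alpha>) = weight \<alpha>"
  by (simp add: diagram_Sigma is_partition_def weight_def)

lemma weight_eq_sum:
  assumes "\<forall>i\<ge>n. \<alpha> i = 0"
  shows "weight \<alpha> = (\<Sum>i<n. \<alpha> i)"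
  unfolding weight_def using assms by (intro sum.mono_neutral_left) (auto simp: not_less[symmetric])

lemma partition_bound:
  assumes "is_partition \<alpha>"
  obtains n where "\<forall>i\<ge>n. \<alpha> i = 0"
proof -
  obtain n where "\<forall>i\<in>{i. \<alpha> i \<noteq> 0}. i < n"
    using assms finite_nat_set_iff_bounded unfolding is_partition_def by blast
  then show ?thesis using that[of n] by force
qed

lemma partitionD: "is_partition \<alpha> \<Longrightarrow> i \<le> j \<Longrightarrow> \<alpha> j \<le> \<alpha> i"
  unfolding is_partition_def antimono_def by blast

lemma diagram_down:
  assumes "is_partition \<alpha>" "(i, j) \<in> diagram \<alpha>" "i' \<le> i" "j' \<le> j"
  shows "(i', j') \<in> diagram \<alpha>"
  using assms partitionD[of \<alpha> i' i] by (auto simp: diagram_def)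

section \<open>Removable corners and the branching rule for standard tableaux\<close>

definition corner :: "(nat \<Rightarrow> nat) \<Rightarrow> nat \<Rightarrow> bool" where
  "corner \<alpha> i \<longleftrightarrow> \<alpha> (Suc i) < \<alpha> i"

definition remove_corner :: "(nat \<Rightarrow> nat) \<Rightarrow> nat \<Rightarrow> (nat \<Rightarrow> nat)" where
  "remove_corner \<alpha> i = \<alpha>(i := \<alpha> i - 1)"

lemma diagram_remove_corner:
  assumes "corner \<alpha> i"
  shows "diagram \<alpha> = insert (i, \<alpha> i - 1) (diagram (remove_corner \<alpha> i))"
    and "(i, \<alpha> i - 1) \<notin> diagram (remove_corner \<alpha> i)"
  using assms by (auto simp: diagram_def remove_corner_def corner_def split: if_splits)

lemma partition_remove_corner:
  assumes "is_partition \<alpha>" "corner \<alpha> i"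
  shows "is_partition (remove_corner \<alpha> i)"
proof -
  have "antimono (remove_corner \<alpha> i)"
  proof (rule antimonoI)
    fix a b :: nat assume "a \<le> b"
    then show "remove_corner \<alpha> i b \<le> remove_corner \<alpha> i a"
      using partitionD[OF assms(1), of a b] partitionD[OF assms(1), of "Suc i" b] assms(2)
      by (cases "a = i \<and> b \<noteq> i") (auto simp: remove_corner_def corner_def)
  qed
  moreover have "finite {k. remove_corner \<alpha> i k \<noteq> 0}"
    using assms(1) unfolding is_partition_def remove_corner_def
    by (auto elim: rev_finite_subset)
  ultimately show ?thesis by (simp add: is_partition_def)
qed

lemma weight_remove_corner:
  assumes "is_partition \<alpha>" "corner \<alpha> i"
  shows "weight \<alpha> = Suc (weight (remove_corner \<alpha> i))"
  using diagram_remove_corner[OF assms(2)] diagram_finite[OF partition_remove_corner[OF assms]]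
    card_diagram[OF assms(1)] card_diagram[OF partition_remove_corner[OF assms]]
  by simp

lemma finite_tableaux:
  assumes "is_partition \<alpha>"
  shows "finite (tableaux \<alpha>)"
proof (rule finite_subset)
  show "tableaux \<alpha> \<subseteq> diagram \<alpha> \<rightarrow>\<^sub>E {1..weight \<alpha>}"
    by (auto simp: tableaux_def bij_betw_def PiE_def)
  show "finite (diagram \<alpha> \<rightarrow>\<^sub>E {1..weight \<alpha>})"
    using diagram_finite[OF assms] by (intro finite_PiE) auto
qed

lemma standard_subset: "standard_tableaux \<alpha> \<subseteq> tableaux \<alpha>"
  by (auto simp: standard_tableaux_def)

text \<open>Deleting the cell of the largest entry and putting it back are inverse bijections;
  \<open>?f\<close> restricts so that the smaller tableau is again extensional.\<close>

lemma card_standard_max_at_corner: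
  assumes \<alpha>: "is_partition \<alpha>" and i: "corner \<alpha> i"
  shows "card {T \<in> standard_tableaux \<alpha>. T (i, \<alpha> i - 1) = weight \<alpha>}
       = num_SYT (remove_corner \<alpha> i)"
proof -
  let ?\<beta> = "remove_corner \<alpha> i" and ?c = "(i, \<alpha> i - 1)"
  let ?f = "\<lambda>T. restrict T (diagram ?\<beta>)" and ?g = "\<lambda>T. T(?c := weight \<alpha>)"
  let ?S = "{T \<in> standard_tableaux \<alpha>. T ?c = weight \<alpha>}"
  note D = diagram_remove_corner[OF i]
  note \<beta> = partition_remove_corner[OF \<alpha> i]
  have w: "weight \<alpha> = Suc (weight ?\<beta>)" by (rule weight_remove_corner[OF \<alpha> i])
  have "bij_betw ?f ?S (standard_tableaux ?\<beta>)"
  proof (rule bij_betw_byWitness[where f' = ?g])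
    show "\<forall>T\<in>?S. ?g (?f T) = T"
      using D by (auto simp: standard_tableaux_def tableaux_def fun_eq_iff extensional_def restrict_def)
    show "\<forall>T\<in>standard_tableaux ?\<beta>. ?f (?g T) = T"
      using D by (auto simp: standard_tableaux_def tableaux_def fun_eq_iff extensional_def restrict_def)
    show "?f ` ?S \<subseteq> standard_tableaux ?\<beta>"
    proof safe
      fix T assume T: "T \<in> standard_tableaux \<alpha>" "T ?c = weight \<alpha>"
      then have "bij_betw T (diagram \<alpha>) {1..weight \<alpha>}"
        by (auto simp: standard_tableaux_def tableaux_def)
      then have "bij_betw T (diagram \<alpha> - {?c}) ({1..weight \<alpha>} - {T ?c})"
        using D by (intro bij_betw_DiffI) (auto simp: bij_betw_def)
      moreover have "diagram \<alpha> - {?c} = diagram ?\<beta>" using D by auto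
      moreover have "{1..weight \<alpha>} - {T ?c} = {1..weight ?\<beta>}" using T w by auto
      ultimately have "bij_betw T (diagram ?\<beta>) {1..weight ?\<beta>}" by simp
      then have "?f T \<in> tableaux ?\<beta>"
        by (simp add: tableaux_def bij_betw_restrict_eq)
      then show "?f T \<in> standard_tableaux ?\<beta>"
        using T(1) D diagram_down[OF \<beta>]
        unfolding standard_tableaux_def by (auto simp: less_imp_le)
    qed
    show "?g ` standard_tableaux ?\<beta> \<subseteq> ?S"
    proof safe
      fix T assume T: "T \<in> standard_tableaux ?\<beta>"
      then have bij: "bij_betw T (diagram ?\<beta>) {1..weight ?\<beta>}"
        by (auto simp: standard_tableaux_def tableaux_def)
      have "bij_betw (?g T) (diagram ?\<beta>) {1..weight ?\<beta>}"
        using bij D by (subst bij_betw_cong[of _ _ T]) auto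
      then have "bij_betw (?g T) (insert ?c (diagram ?\<beta>)) (insert (?g T ?c) {1..weight ?\<beta>})"
        using D w unfolding bij_betw_def by auto
      moreover have "insert (?g T ?c) {1..weight ?\<beta>} = {1..weight \<alpha>}" using w by auto
      ultimately have "bij_betw (?g T) (diagram \<alpha>) {1..weight \<alpha>}" using D by simp
      moreover have "?g T \<in> extensional (diagram \<alpha>)"
        using T D by (auto simp: standard_tableaux_def tableaux_def extensional_def)
      ultimately have tab: "?g T \<in> tableaux \<alpha>" by (simp add: tableaux_def)
      have lt: "T c < weight \<alpha>" if "c \<in> diagram ?\<beta>" for c
        using bij_betw_apply[OF bij that] w by auto
      have "?g T (a, b) < ?g T (a, b')" if "b < b'" "(a, b') \<in> diagram \<alpha>" for a b b'
      proof -
        have ab: "(a, b) \<in> diagram ?\<beta>"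
          using that i by (auto simp: diagram_def remove_corner_def)
        show ?thesis
        proof (cases "(a, b') = ?c")
          case True
          then show ?thesis using lt[OF ab] ab D by auto
        next
          case False
          then have "(a, b') \<in> diagram ?\<beta>" using that D by auto
          then show ?thesis using False ab D T that by (auto simp: standard_tableaux_def)
        qed
      qed
      moreover have "?g T (a, b) < ?g T (a', b)" if "a < a'" "(a', b) \<in> diagram \<alpha>" for a a' b
      proof -
        \<comment> \<open>A cell with another cell of the shape below it is not the removed corner,
          because row \<open>Suc i\<close>, and hence every later row, is shorter than row
          \<open>i\<close>.\<close>
        have ab: "(a, b) \<in> diagram ?\<beta>"
          using that i partitionD[OF \<alpha>, of a a'] partitionD[OF \<alpha>, of "Suc i" a']
          by (auto simp: diagram_def remove_corner_def corner_def)
        show ?thesis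
        proof (cases "(a', b) = ?c")
          case True
          then show ?thesis using lt[OF ab] ab D by auto
        next
          case False
          then have "(a', b) \<in> diagram ?\<beta>" using that D by auto
          then show ?thesis using False ab D T that by (auto simp: standard_tableaux_def)
        qed
      qed
      ultimately show "?g T \<in> standard_tableaux \<alpha>"
        using tab unfolding standard_tableaux_def by blast
      show "?g T ?c = weight \<alpha>" by simp
    qed
  qed
  then show ?thesis unfolding num_SYT_def by (rule bij_betw_same_card)
qed

text \<open>Standard tableaux are sorted by the position of their largest entry, which can only be a
  removable corner. Any bound \<open>n\<close> on the number of rows is allowed, so the same
  \<open>n\<close> survives the removal of cells.\<close>

lemma num_SYT_branching:
  assumes \<alpha>: "is_partition \<alpha>" and n: "\<forall>i\<ge>n. \<alpha> i = 0" and pos: "weight \<alpha> > 0"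
  shows "num_SYT \<alpha> = (\<Sum>i | i < n \<and> corner \<alpha> i. num_SYT (remove_corner \<alpha> i))"
proof -
  let ?C = "{i. i < n \<and> corner \<alpha> i}"
  let ?S = "\<lambda>i. {T \<in> standard_tableaux \<alpha>. T (i, \<alpha> i - 1) = weight \<alpha>}"
  have bij: "bij_betw T (diagram \<alpha>) {1..weight \<alpha>}" if "T \<in> standard_tableaux \<alpha>" for T
    using that by (auto simp: standard_tableaux_def tableaux_def)
  have "standard_tableaux \<alpha> = (\<Union>i\<in>?C. ?S i)"
  proof (intro equalityI subsetI)
    fix T assume T: "T \<in> standard_tableaux \<alpha>"
    have "weight \<alpha> \<in> T ` diagram \<alpha>" using bij[OF T] pos by (auto simp: bij_betw_def)
    then obtain i j where ij: "(i, j) \<in> diagram \<alpha>" "T (i, j) = weight \<alpha>" by force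
    have le: "T c \<le> weight \<alpha>" if "c \<in> diagram \<alpha>" for c
      using bij[OF T] that by (force simp: bij_betw_def)
    have "T (i, j) < T (i, Suc j)" if "(i, Suc j) \<in> diagram \<alpha>"
      using T that unfolding standard_tableaux_def by blast
    moreover have "T (i, j) < T (Suc i, j)" if "(Suc i, j) \<in> diagram \<alpha>"
      using T that unfolding standard_tableaux_def by blast
    ultimately have "(i, Suc j) \<notin> diagram \<alpha>" "(Suc i, j) \<notin> diagram \<alpha>"
      using le ij(2) by (metis leD)+
    then have "j = \<alpha> i - 1" "corner \<alpha> i" using ij(1) by (auto simp: diagram_def corner_def)
    moreover have "i < n" using ij n by (force simp: diagram_def not_less[symmetric])
    ultimately show "T \<in> (\<Union>i\<in>?C. ?S i)" using T ij by auto
  qed auto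
  then have "num_SYT \<alpha> = card (\<Union>i\<in>?C. ?S i)" by (simp add: num_SYT_def)
  also have "\<dots> = (\<Sum>i\<in>?C. card (?S i))"
  proof (rule card_UN_disjoint)
    show "\<forall>i\<in>?C. finite (?S i)"
      using finite_subset[OF standard_subset finite_tableaux[OF \<alpha>]] by auto
    have "i = i'" if "corner \<alpha> i" "corner \<alpha> i'" "T \<in> ?S i" "T \<in> ?S i'" for i i' T
    proof -
      have "(i, \<alpha> i - 1) \<in> diagram \<alpha>" "(i', \<alpha> i' - 1) \<in> diagram \<alpha>"
        using that by (auto simp: diagram_def corner_def)
      moreover have "T (i, \<alpha> i - 1) = T (i', \<alpha> i' - 1)" using that by simp
      ultimately show ?thesis using bij[of T] that(3) by (metis (mono_tags, lifting) Pair_inject bij_betw_inv_into_left mem_Collect_eq)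
    qed
    then show "\<forall>i\<in>?C. \<forall>i'\<in>?C. i \<noteq> i' \<longrightarrow> ?S i \<inter> ?S i' = {}" by blast
  qed simp
  also have "\<dots> = (\<Sum>i\<in>?C. num_SYT (remove_corner \<alpha> i))"
    using card_standard_max_at_corner[OF \<alpha>] by simp
  finally show ?thesis .
qed

text \<open>The strictly decreasing sequence \<open>l\<^sub>i = \<alpha>\<^sub>i + n - i\<close> (1-based) of the Frobenius
  formula; the subtraction is exact only for \<open>i < n\<close>.\<close>

definition shifted :: "nat \<Rightarrow> (nat \<Rightarrow> nat) \<Rightarrow> nat \<Rightarrow> nat" where
  "shifted n \<alpha> i = \<alpha> i + (n - 1 - i)"

lemma shifted_less:
  assumes "is_partition \<alpha>" "a < b" "b < n"
  shows "shifted n \<alpha> b < shifted n \<alpha> a"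
  using partitionD[OF assms(1), of a b] assms by (simp add: shifted_def)

text \<open>The staircase \<open>n - 1 - i\<close> sums to \<open>n choose 2\<close>, exactly the
  constant subtracted in \<open>sum_vandermonde_shift\<close>; the factor left there is the size of
  the shape.\<close>

lemma sum_shifted: "(\<Sum>i<n. shifted n \<alpha> i) = (\<Sum>i<n. \<alpha> i) + (n choose 2)"
proof -
  have "(\<Sum>i<n. n - 1 - i) = (\<Sum>i<n. i)"
    by (rule sum.reindex_bij_witness[where i = "\<lambda>i. n - 1 - i" and j = "\<lambda>i. n - 1 - i"]) auto
  also have "\<dots> = (n choose 2)"
    by (induction n) (auto simp: numeral_2_eq_2)
  finally show ?thesis by (simp only: shifted_def sum.distrib)
qed

text \<open>Induction on the size with \<open>n\<close> fixed. From
  \<open>remove_corner \<alpha> i\<close> back to \<alpha>, the factorial at \<open>i\<close> gains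
  the factor \<open>shifted n \<alpha> i\<close>, which is the weight \<open>x i\<close> in the
  Vandermonde identity.\<close>

lemma frobenius_formula:
  assumes "is_partition \<alpha>" "\<forall>i\<ge>n. \<alpha> i = 0"
  shows "real (num_SYT \<alpha>) * (\<Prod>i<n. fact (shifted n \<alpha> i))
       = fact (weight \<alpha>) * vandermonde n (\<lambda>i. real (shifted n \<alpha> i))"
  using assms
proof (induction "weight \<alpha>" arbitrary: \<alpha>)
  case 0
  then have "diagram \<alpha> = {}"
    using card_diagram diagram_finite by force
  have zero: "\<alpha> i = 0" for i
    using \<open>diagram \<alpha> = {}\<close> by (auto simp: diagram_def)
  have "standard_tableaux \<alpha> = {\<lambda>_. undefined}"
    using \<open>diagram \<alpha> = {}\<close> 0 by (auto simp: standard_tableaux_def tableaux_def bij_betw_def)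
  then have "num_SYT \<alpha> = 1" by (simp add: num_SYT_def)
  \<comment> \<open>For the empty shape the shifted sequence is \<open>n - 1, ..., 1, 0\<close>,
    whose Vandermonde product is the product of its factorials.\<close>
  moreover have "(\<Prod>i<n. fact (n - 1 - i)) = (\<Prod>b<n. \<Prod>a<b. real b - real a)"
  proof -
    have "(\<Prod>i<n. fact (n - 1 - i)) = (\<Prod>b<n. fact b :: real)"
      by (rule prod.reindex_bij_witness[where i = "\<lambda>i. n - 1 - i" and j = "\<lambda>i. n - 1 - i"]) auto
    also have "\<dots> = (\<Prod>b<n. \<Prod>a<b. real b - real a)"
    proof (rule prod.cong[OF refl])
      fix b
      have "(\<Prod>a<b. real b - real a) = (\<Prod>a<b. real (Suc a))"
        by (rule prod.reindex_bij_witness[where i = "\<lambda>i. b - 1 - i" and j = "\<lambda>i. b - 1 - i"])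
          (auto simp: of_nat_diff)
      also have "\<dots> = fact b" by (simp add: fact_prod_Suc atLeast0LessThan)
      finally show "fact b = (\<Prod>a<b. real b - real a)" by simp
    qed
    finally show ?thesis .
  qed
  moreover have "vandermonde n (\<lambda>i. real (shifted n \<alpha> i)) = (\<Prod>b<n. \<Prod>a<b. real b - real a)"
    unfolding vandermonde_def by (intro prod.cong) (auto simp: shifted_def zero of_nat_diff)
  ultimately show ?case using 0(1)[symmetric]
    by (simp only: shifted_def zero[abs_def] zero add_0 of_nat_1 mult_1 fact_0)
next
  case (Suc m)
  let ?x = "\<lambda>i. real (shifted n \<alpha> i)"
  let ?F = "\<Prod>i<n. fact (shifted n \<alpha> i) :: real"
  let ?V = "\<lambda>i. vandermonde n (?x(i := ?x i - 1))"
  let ?C = "{i. i < n \<and> corner \<alpha> i}"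
  have corner: "real (num_SYT (remove_corner \<alpha> i)) * ?F = fact m * (?x i * ?V i)"
    if "i \<in> ?C" for i
  proof -
    let ?\<beta> = "remove_corner \<alpha> i"
    have i: "i < n" "corner \<alpha> i" using that by auto
    have pos: "\<alpha> i > 0" using i by (auto simp: corner_def)
    have "m = weight ?\<beta>" using weight_remove_corner[OF Suc.prems(1) i(2)] Suc.hyps(2) by simp
    moreover have "\<forall>k\<ge>n. ?\<beta> k = 0" using Suc.prems(2) i by (simp add: remove_corner_def)
    ultimately have IH: "real (num_SYT ?\<beta>) * (\<Prod>k<n. fact (shifted n ?\<beta> k))
        = fact m * vandermonde n (\<lambda>k. real (shifted n ?\<beta> k))"
      using Suc.hyps(1)[of ?\<beta>] partition_remove_corner[OF Suc.prems(1) i(2)] by simp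
    have "(\<lambda>k. real (shifted n ?\<beta> k)) = ?x(i := ?x i - 1)"
      using pos by (auto simp: fun_eq_iff shifted_def remove_corner_def)
    moreover have "?F = ?x i * (\<Prod>k<n. fact (shifted n ?\<beta> k))"
    proof -
      have "(fact (shifted n \<alpha> i) :: real) = ?x i * fact (shifted n ?\<beta> i)"
        using pos by (subst fact_reduce) (auto simp: shifted_def remove_corner_def)
      moreover have "(\<Prod>k\<in>{..<n} - {i}. fact (shifted n ?\<beta> k))
          = (\<Prod>k\<in>{..<n} - {i}. fact (shifted n \<alpha> k) :: real)"
        by (intro prod.cong) (auto simp: shifted_def remove_corner_def)
      ultimately show ?thesis using i by (simp add: prod.remove[of "{..<n}" i])
    qed
    ultimately show ?thesis using IH by simp
  qed
  \<comment> \<open>If rows \<open>i\<close> and \<open>Suc i\<close> are equally long, lowering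
    \<open>x i\<close> makes two neighbours of the sequence equal. If \<open>i\<close> is the last
    index below \<open>n\<close> and not a corner, its row is empty and \<open>x i\<close> itself is
    0.\<close>
  have noncorner: "?x i * ?V i = 0" if "i < n" "\<not> corner \<alpha> i" for i
  proof (cases "Suc i < n")
    case True
    have "\<alpha> (Suc i) = \<alpha> i"
      using that partitionD[OF Suc.prems(1), of i "Suc i"] by (simp add: corner_def)
    then have "?V i = 0"
      using True by (intro vandermonde_eq_0[of i "Suc i"]) (auto simp: shifted_def of_nat_diff)
    then show ?thesis by simp
  next
    case False
    then have "\<alpha> (Suc i) = 0" using Suc.prems(2) by simp
    then show ?thesis using False that by (simp add: shifted_def corner_def)
  qed
  have inj: "inj_on ?x {..<n}"
    unfolding inj_on_def using shifted_less[OF Suc.prems(1)]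
    by (metis lessThan_iff less_irrefl linorder_neqE_nat of_nat_eq_iff)
  have "real (num_SYT \<alpha>) * ?F = (\<Sum>i\<in>?C. real (num_SYT (remove_corner \<alpha> i)) * ?F)"
    using num_SYT_branching[OF Suc.prems] Suc.hyps(2) by (simp add: sum_distrib_right)
  also have "\<dots> = fact m * (\<Sum>i\<in>?C. ?x i * ?V i)"
    using corner by (simp add: sum_distrib_left)
  also have "(\<Sum>i\<in>?C. ?x i * ?V i) = (\<Sum>i<n. ?x i * ?V i)"
    using noncorner by (intro sum.mono_neutral_left) auto
  also have "\<dots> = ((\<Sum>i<n. ?x i) - real (n choose 2)) * vandermonde n ?x"
    by (rule sum_vandermonde_shift[OF inj])
  also have "(\<Sum>i<n. ?x i) - real (n choose 2) = real (weight \<alpha>)"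
    using sum_shifted[of n \<alpha>] weight_eq_sum[OF Suc.prems(2)]
    by (metis add_diff_cancel_right' of_nat_add of_nat_sum)
  finally show ?case using Suc.hyps(2)[symmetric] by (simp add: algebra_simps)
qed

subsection \<open>Midpoint inequality for standard tableaux\<close>

text \<open>Log-convexity of the factorial is the maximality of the central binomial coefficient:
  \<open>fact a * fact b * (2 * c choose a)\<close> is \<open>fact (2 * c)\<close> for every such
  split of \<open>2 * c\<close>.\<close>

lemma fact_midpoint:
  fixes a b c :: nat
  assumes "a + b = 2 * c"
  shows "(fact c :: nat)\<^sup>2 \<le> fact a * fact b"
proof -
  have "(2 * c choose a) \<le> (2 * c choose c)"
    using binomial_maximum[of "2 * c" a] by simp
  moreover have ba: "a \<le> 2 * c" "2 * c - a = b" "2 * c - c = c" using assms by auto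
  have "fact a * fact b * (2 * c choose a) = fact c * fact c * (2 * c choose c)"
    using binomial_fact_lemma[of a "2 * c"] binomial_fact_lemma[of c "2 * c"] ba
    by (simp add: mult.assoc mult.left_commute)
  ultimately have "fact c * fact c * (2 * c choose c) \<le> fact a * fact b * (2 * c choose c)"
    by (metis mult_le_mono2)
  then show ?thesis by (simp add: power2_eq_square)
qed

lemma mult_le_power2_midpoint:
  fixes p q r :: real
  assumes "p + q = 2 * r"
  shows "p * q \<le> r\<^sup>2"
proof -
  have q: "q = 2 * r - p" using assms by simp
  have "r\<^sup>2 - p * q = ((p - q) / 2)\<^sup>2"
    unfolding q by (simp add: power2_eq_square field_simps)
  then show ?thesis by (metis diff_ge_0_iff_ge zero_le_power2)
qed

text \<open>The midpoint is any \<gamma> with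
  \<open>2 * \<gamma> i = \<alpha> i + \<beta> i\<close>, a form that fits \<open>half_sum\<close>
  as well as its padded version.\<close>

lemma
  assumes \<alpha>: "is_partition \<alpha>" and \<beta>: "is_partition \<beta>" and mid: "\<And>i. 2 * \<gamma> i = \<alpha> i + \<beta> i"
  shows is_partition_midpoint: "is_partition \<gamma>"
    and weight_midpoint: "2 * weight \<gamma> = weight \<alpha> + weight \<beta>"
proof -
  obtain n1 n2 where "\<forall>i\<ge>n1. \<alpha> i = 0" "\<forall>i\<ge>n2. \<beta> i = 0"
    using partition_bound \<alpha> \<beta> by metis
  then have n: "\<forall>i\<ge>max n1 n2. \<alpha> i = 0" "\<forall>i\<ge>max n1 n2. \<beta> i = 0" by auto
  have n\<gamma>: "\<forall>i\<ge>max n1 n2. \<gamma> i = 0" using n mid by (metis add_0 mult_eq_0_iff zero_neq_numeral)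
  have "\<gamma> j \<le> \<gamma> i" if "i \<le> j" for i j
    using mid[of i] mid[of j] partitionD[OF \<alpha> that] partitionD[OF \<beta> that] by linarith
  moreover have "finite {i. \<gamma> i \<noteq> 0}"
    using n\<gamma> by (auto intro!: finite_subset[of _ "{..<max n1 n2}"] simp: not_less[symmetric])
  ultimately show "is_partition \<gamma>" by (auto simp: is_partition_def antimono_def)
  show "2 * weight \<gamma> = weight \<alpha> + weight \<beta>"
    using weight_eq_sum[OF n(1)] weight_eq_sum[OF n(2)] weight_eq_sum[OF n\<gamma>] mid
    by (simp add: sum_distrib_left flip: sum.distrib)
qed

lemma num_SYT_midpoint:
  assumes \<alpha>: "is_partition \<alpha>" and \<beta>: "is_partition \<beta>"
    and mid: "\<And>i. 2 * \<gamma> i = \<alpha> i + \<beta> i" and w: "weight \<beta> = weight \<alpha>"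
  shows "num_SYT \<alpha> * num_SYT \<beta> \<le> (num_SYT \<gamma>)\<^sup>2"
proof -
  note \<gamma> = is_partition_midpoint[OF \<alpha> \<beta> mid]
  have w\<gamma>: "weight \<gamma> = weight \<alpha>" using weight_midpoint[OF \<alpha> \<beta> mid] w by simp
  obtain n1 n2 n3 where "\<forall>i\<ge>n1. \<alpha> i = 0" "\<forall>i\<ge>n2. \<beta> i = 0" "\<forall>i\<ge>n3. \<gamma> i = 0"
    using partition_bound \<alpha> \<beta> \<gamma> by metis
  then obtain n where n: "\<forall>i\<ge>n. \<alpha> i = 0" "\<forall>i\<ge>n. \<beta> i = 0" and n\<gamma>: "\<forall>i\<ge>n. \<gamma> i = 0"
    using that[of "max n1 (max n2 n3)"] by auto
  let ?F = "\<lambda>\<alpha>. \<Prod>i<n. fact (shifted n \<alpha> i) :: real"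
  let ?V = "\<lambda>\<alpha>. vandermonde n (\<lambda>i. real (shifted n \<alpha> i))"
  have Fpos: "?F \<alpha> > 0" for \<alpha> by (intro prod_pos) auto
  have smid: "shifted n \<alpha> i + shifted n \<beta> i = 2 * shifted n \<gamma> i" for i
    using mid[of i] by (simp add: shifted_def)
  have f: "real (num_SYT \<alpha>) = fact (weight \<alpha>) * ?V \<alpha> / ?F \<alpha>"
    if "is_partition \<alpha>" "\<forall>i\<ge>n. \<alpha> i = 0" for \<alpha>
    using frobenius_formula[OF that] Fpos[of \<alpha>] by (simp add: field_simps)
  have "(fact (shifted n \<gamma> i))\<^sup>2 \<le> (fact (shifted n \<alpha> i) * fact (shifted n \<beta> i) :: real)" for i
    using fact_midpoint[OF smid[of i]]
    by (metis of_nat_fact of_nat_le_iff of_nat_mult of_nat_power)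
  then have F: "(?F \<gamma>)\<^sup>2 \<le> ?F \<alpha> * ?F \<beta>"
    unfolding prod.distrib[symmetric] prod_power_distrib
    by (intro prod_mono) auto
  have V: "?V \<alpha> * ?V \<beta> \<le> (?V \<gamma>)\<^sup>2"
    unfolding vandermonde_def prod.distrib[symmetric] prod_power_distrib
  proof (intro prod_mono conjI)
    fix b a assume ab: "b \<in> {..<n}" "a \<in> {..<b}"
    let ?d = "\<lambda>\<alpha>. real (shifted n \<alpha> a) - real (shifted n \<alpha> b)"
    \<comment> \<open>Comparing products factor by factor requires nonnegative factors; the shifted
      sequences of \<alpha> and \<beta> are strictly decreasing.\<close>
    have "?d \<alpha> \<ge> 0" "?d \<beta> \<ge> 0"
      using shifted_less[OF \<alpha>, of a b n] shifted_less[OF \<beta>, of a b n] ab by auto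
    then show "0 \<le> ?d \<alpha> * ?d \<beta>" by simp
    have "real (shifted n \<alpha> a) + real (shifted n \<beta> a) = 2 * real (shifted n \<gamma> a)"
      "real (shifted n \<alpha> b) + real (shifted n \<beta> b) = 2 * real (shifted n \<gamma> b)"
      using smid[of a] smid[of b] by linarith+
    then show "?d \<alpha> * ?d \<beta> \<le> (?d \<gamma>)\<^sup>2"
      by (intro mult_le_power2_midpoint) simp
  next
    fix b assume b: "b \<in> {..<n}"
    show "0 \<le> (\<Prod>a<b. (real (shifted n \<alpha> a) - real (shifted n \<alpha> b))
      * (real (shifted n \<beta> a) - real (shifted n \<beta> b)))"
      using shifted_less[OF \<alpha>, of _ b n] shifted_less[OF \<beta>, of _ b n] b
      by (intro prod_nonneg) (auto intro!: mult_nonneg_nonneg simp: less_imp_le)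
  qed
  have "real (num_SYT \<alpha>) * real (num_SYT \<beta>)
      = (fact (weight \<alpha>))\<^sup>2 * (?V \<alpha> * ?V \<beta> / (?F \<alpha> * ?F \<beta>))"
    using f[OF \<alpha> n(1)] f[OF \<beta> n(2)] w by (simp add: power2_eq_square)
  \<comment> \<open>\<open>V\<close> enlarges the numerator and \<open>F\<close> shrinks the
    denominator.\<close>
  also have "\<dots> \<le> (fact (weight \<alpha>))\<^sup>2 * ((?V \<gamma>)\<^sup>2 / (?F \<gamma>)\<^sup>2)"
    using F V Fpos[of \<gamma>] by (intro mult_left_mono frac_le) auto
  also have "\<dots> = (real (num_SYT \<gamma>))\<^sup>2"
    using f[OF \<gamma> n\<gamma>] w\<gamma> by (simp add: power2_eq_square)
  finally show ?thesis by (metis of_nat_le_iff of_nat_mult of_nat_power)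
qed

subsection \<open>Independence of the standard polytabloids\<close>

lemma tableau_bij: "T \<in> tableaux \<alpha> \<Longrightarrow> bij_betw T (diagram \<alpha>) {1..weight \<alpha>}"
  by (simp add: tableaux_def)

lemma tableau_eqI:
  assumes "T \<in> tableaux \<alpha>" "U \<in> tableaux \<alpha>" "\<And>c. c \<in> diagram \<alpha> \<Longrightarrow> T c = U c"
  shows "T = U"
  using assms by (auto simp: tableaux_def intro: extensionalityI)

lemma tableau_inj:
  "T \<in> tableaux \<alpha> \<Longrightarrow> c \<in> diagram \<alpha> \<Longrightarrow> c' \<in> diagram \<alpha> \<Longrightarrow> T c = T c' \<Longrightarrow> c = c'"
  by (auto simp: tableaux_def bij_betw_def dest: inj_onD)

lemma perm_tableau_apply [simp]: "c \<in> diagram \<alpha> \<Longrightarrow> perm_tableau \<alpha> \<sigma> T c = \<sigma> (T c)"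
  by (simp add: perm_tableau_def)

lemma perm_tableau_in:
  assumes "T \<in> tableaux \<alpha>" "\<sigma> permutes {1..weight \<alpha>}"
  shows "perm_tableau \<alpha> \<sigma> T \<in> tableaux \<alpha>"
  using bij_betw_trans[OF tableau_bij[OF assms(1)] permutes_imp_bij[OF assms(2)]]
  by (simp add: tableaux_def perm_tableau_def bij_betw_restrict_eq)

lemma perm_tableau_comp:
  "perm_tableau \<alpha> \<sigma> (perm_tableau \<alpha> \<tau> T) = perm_tableau \<alpha> (\<sigma> \<circ> \<tau>) T"
  by (auto simp: perm_tableau_def fun_eq_iff restrict_def)

lemma row_entries_perm: "row_entries \<alpha> (perm_tableau \<alpha> \<sigma> T) i = \<sigma> ` row_entries \<alpha> T i"
  unfolding row_entries_def image_Collect by (rule Collect_cong) (metis perm_tableau_apply)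

lemma column_entries_perm:
  "column_entries \<alpha> (perm_tableau \<alpha> \<sigma> T) j = \<sigma> ` column_entries \<alpha> T j"
  unfolding column_entries_def image_Collect by (rule Collect_cong) (metis perm_tableau_apply)

lemma tabloid_cong:
  "(\<And>i. row_entries \<alpha> T i = row_entries \<alpha> U i) \<Longrightarrow> tabloid \<alpha> T = tabloid \<alpha> U"
  by (simp add: tabloid_def)

lemma tabloid_eqD:
  assumes "tabloid \<alpha> T = tabloid \<alpha> U" "T \<in> tableaux \<alpha>"
  shows "row_entries \<alpha> T i = row_entries \<alpha> U i"
proof -
  have "T \<in> tabloid \<alpha> T" using assms(2) by (simp add: tabloid_def)
  then have "T \<in> tabloid \<alpha> U" using assms(1) by simp
  then show ?thesis by (simp add: tabloid_def)
qed

lemma permutes_interval_permutation: "\<sigma> permutes {1..n::nat} \<Longrightarrow> permutation \<sigma>"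
  by (rule permutation_permutes[THEN iffD2]) blast

text \<open>The column stabilizer of the permuted tableau is the conjugate by \<sigma> of that of
  \<open>T\<close>, and conjugation preserves signs. This is the group action on polytabloids,
  written out on coefficients.\<close>

lemma polytabloid_perm:
  assumes "\<sigma> permutes {1..weight \<alpha>}"
  shows "polytabloid \<alpha> (perm_tableau \<alpha> \<sigma> T) X
    = (\<Sum>\<pi>\<in>column_stabilizer \<alpha> T. of_int (sign \<pi>) * of_bool (X = tabloid \<alpha> (perm_tableau \<alpha> (\<sigma> \<circ> \<pi>) T)))"
  unfolding polytabloid_def
proof (rule sum.reindex_bij_witness[where i = "\<lambda>\<pi>. \<sigma> \<circ> \<pi> \<circ> inv \<sigma>" and j = "\<lambda>\<tau>. inv \<sigma> \<circ> \<tau> \<circ> \<sigma>"])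
  note inv = permutes_inverses[OF assms] and \<sigma>' = permutes_inv[OF assms]
  have inv_image: "\<sigma> ` inv \<sigma> ` A = A" "inv \<sigma> ` \<sigma> ` A = A" for A
    using inv by (auto simp: image_iff)
  fix \<tau> assume \<tau>: "\<tau> \<in> column_stabilizer \<alpha> (perm_tableau \<alpha> \<sigma> T)"
  then have p: "\<tau> permutes {1..weight \<alpha>}"
    and c: "\<tau> ` \<sigma> ` column_entries \<alpha> T j = \<sigma> ` column_entries \<alpha> T j" for j
    by (auto simp: column_stabilizer_def column_entries_perm)
  show "\<sigma> \<circ> (inv \<sigma> \<circ> \<tau> \<circ> \<sigma>) \<circ> inv \<sigma> = \<tau>" using inv by (simp add: fun_eq_iff)
  show "inv \<sigma> \<circ> \<tau> \<circ> \<sigma> \<in> column_stabilizer \<alpha> T"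
    unfolding column_stabilizer_def using c inv_image
    by (auto simp only: mem_Collect_eq image_comp[symmetric] intro!: permutes_compose[OF assms] permutes_compose[OF p] \<sigma>')
  have "sign (inv \<sigma> \<circ> \<tau> \<circ> \<sigma>) = sign \<tau>"
    using permutes_interval_permutation[OF assms] permutes_interval_permutation[OF p]
      permutes_interval_permutation[OF \<sigma>']
    by (simp add: sign_compose permutation_compose sign_inverse mult.commute)
  then show "of_int (sign (inv \<sigma> \<circ> \<tau> \<circ> \<sigma>)) *
      of_bool (X = tabloid \<alpha> (perm_tableau \<alpha> (\<sigma> \<circ> (inv \<sigma> \<circ> \<tau> \<circ> \<sigma>)) T))
    = (of_int (sign \<tau>) * of_bool (X = tabloid \<alpha> (perm_tableau \<alpha> \<tau> (perm_tableau \<alpha> \<sigma> T))) :: complex)"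
    using inv by (simp add: perm_tableau_comp comp_def)
next
  note inv = permutes_inverses[OF assms] and \<sigma>' = permutes_inv[OF assms]
  have inv_image: "inv \<sigma> ` \<sigma> ` A = A" for A
    using inv by (auto simp: image_iff)
  fix \<pi> assume "\<pi> \<in> column_stabilizer \<alpha> T"
  then have p: "\<pi> permutes {1..weight \<alpha>}"
    and c: "\<pi> ` column_entries \<alpha> T j = column_entries \<alpha> T j" for j
    by (auto simp: column_stabilizer_def)
  show "inv \<sigma> \<circ> (\<sigma> \<circ> \<pi> \<circ> inv \<sigma>) \<circ> \<sigma> = \<pi>" using inv by (simp add: fun_eq_iff)
  show "\<sigma> \<circ> \<pi> \<circ> inv \<sigma> \<in> column_stabilizer \<alpha> (perm_tableau \<alpha> \<sigma> T)"
    unfolding column_stabilizer_def column_entries_perm using c inv_image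
    by (auto simp only: mem_Collect_eq image_comp[symmetric] intro!: permutes_compose[OF \<sigma>'] permutes_compose[OF p] assms)
qed

lemma column_stabilizer_permutes: "\<pi> \<in> column_stabilizer \<alpha> T \<Longrightarrow> \<pi> permutes {1..weight \<alpha>}"
  by (simp add: column_stabilizer_def)

lemma finite_column_stabilizer [simp]: "finite (column_stabilizer \<alpha> T)"
  by (rule finite_subset[OF _ finite_permutations[of "{1..weight \<alpha>}"]])
    (auto simp: column_stabilizer_def)

lemma column_entries_column_perm:
  assumes "\<pi> \<in> column_stabilizer \<alpha> T"
  shows "column_entries \<alpha> (perm_tableau \<alpha> \<pi> T) j = column_entries \<alpha> T j"
  using assms by (simp add: column_entries_perm column_stabilizer_def)

lemma column_stabilizer_comp:
  assumes "\<pi> \<in> column_stabilizer \<alpha> T" "\<rho> \<in> column_stabilizer \<alpha> T"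
  shows "\<pi> \<circ> \<rho> \<in> column_stabilizer \<alpha> T"
proof -
  have "(\<pi> \<circ> \<rho>) ` column_entries \<alpha> T j = \<pi> ` \<rho> ` column_entries \<alpha> T j" for j
    by (simp only: image_comp)
  then show ?thesis
    using assms permutes_compose[of \<rho> _ \<pi>] by (simp add: column_stabilizer_def)
qed

lemma column_stabilizer_inv:
  assumes "\<pi> \<in> column_stabilizer \<alpha> T"
  shows "inv \<pi> \<in> column_stabilizer \<alpha> T"
proof -
  note p = column_stabilizer_permutes[OF assms]
  have "inv \<pi> ` column_entries \<alpha> T j = column_entries \<alpha> T j" for j
  proof -
    have "inv \<pi> ` \<pi> ` column_entries \<alpha> T j = column_entries \<alpha> T j"
      by (simp add: image_image permutes_inverses[OF p])
    then show ?thesis using assms by (simp add: column_stabilizer_def)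
  qed
  then show ?thesis using permutes_inv[OF p] by (simp add: column_stabilizer_def)
qed

text \<open>Left translation by \<pi> reindexes the column stabilizer and multiplies every sign by
  \<open>sign \<pi>\<close>.\<close>

lemma polytabloid_column_perm:
  assumes "\<pi> \<in> column_stabilizer \<alpha> T"
  shows "polytabloid \<alpha> (perm_tableau \<alpha> \<pi> T) X = of_int (sign \<pi>) * polytabloid \<alpha> T X"
proof -
  note p = column_stabilizer_permutes[OF assms]
  have sgn: "sign (\<pi> \<circ> \<rho>) = sign \<pi> * sign \<rho>" if "\<rho> \<in> column_stabilizer \<alpha> T" for \<rho>
    using permutes_interval_permutation[OF p]
      permutes_interval_permutation[OF column_stabilizer_permutes[OF that]] by (rule sign_compose)
  have "polytabloid \<alpha> T X = (\<Sum>\<rho>\<in>column_stabilizer \<alpha> T.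
      of_int (sign (\<pi> \<circ> \<rho>)) * of_bool (X = tabloid \<alpha> (perm_tableau \<alpha> (\<pi> \<circ> \<rho>) T)))"
    unfolding polytabloid_def
    by (rule sum.reindex_bij_witness[where j = "\<lambda>\<rho>. inv \<pi> \<circ> \<rho>" and i = "\<lambda>\<rho>. \<pi> \<circ> \<rho>"])
      (auto simp: assms column_stabilizer_comp column_stabilizer_inv comp_assoc[symmetric]
        permutes_inv_o[OF p])
  then have "of_int (sign \<pi>) * polytabloid \<alpha> T X = (\<Sum>\<rho>\<in>column_stabilizer \<alpha> T.
      of_int (sign \<rho>) * of_bool (X = tabloid \<alpha> (perm_tableau \<alpha> (\<pi> \<circ> \<rho>) T)))"
    by (simp add: sum_distrib_left sgn mult.assoc[symmetric] flip: of_int_mult)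
  then show ?thesis using polytabloid_perm[OF p] by simp
qed

text \<open>With \<open>w = fst\<close> the potential depends only on the tabloid and is largest, within a
  column orbit, at the column-increasing tableau; with \<open>w = snd\<close> it is invariant under column
  permutations and increases in a Garnir relation.\<close>

definition potential :: "(nat \<times> nat \<Rightarrow> nat) \<Rightarrow> (nat \<Rightarrow> nat) \<Rightarrow> (nat \<times> nat \<Rightarrow> nat) \<Rightarrow> nat" where
  "potential w \<alpha> T = (\<Sum>c\<in>diagram \<alpha>. w c * T c)"

text \<open>A crude bound that turns growth of the potential into descent of a measure: subtracting
  a potential from it does not truncate.\<close>

lemma potential_le:
  assumes "T \<in> tableaux \<alpha>"
  shows "potential w \<alpha> T \<le> (\<Sum>c\<in>diagram \<alpha>. w c * weight \<alpha>)"
  unfolding potential_def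
  using bij_betw_apply[OF tableau_bij[OF assms]] by (intro sum_mono mult_le_mono) auto

lemma row_entries_image: "row_entries \<alpha> T i = (\<lambda>j. T (i, j)) ` {..<\<alpha> i}"
  by (auto simp: row_entries_def diagram_def)

text \<open>The weight \<open>fst\<close> is constant along a row, so only the sum of the entries of
  each row enters.\<close>

lemma potential_fst_cong:
  assumes \<alpha>: "is_partition \<alpha>" and T: "T \<in> tableaux \<alpha>" and U: "U \<in> tableaux \<alpha>"
    and row: "\<And>i. row_entries \<alpha> T i = row_entries \<alpha> U i"
  shows "potential fst \<alpha> T = potential fst \<alpha> U"
proof -
  have "potential fst \<alpha> T = (\<Sum>i | \<alpha> i \<noteq> 0. i * (\<Sum>k\<in>row_entries \<alpha> T i. k))"
    if "T \<in> tableaux \<alpha>" for T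
  proof -
    have inj: "inj_on (\<lambda>j. T (i, j)) {..<\<alpha> i}" for i
      using tableau_inj[OF that] by (auto simp: inj_on_def diagram_def)
    have "potential fst \<alpha> T = (\<Sum>i | \<alpha> i \<noteq> 0. \<Sum>j<\<alpha> i. i * T (i, j))"
      unfolding potential_def diagram_Sigma
      using \<alpha> by (subst sum.Sigma) (auto simp: is_partition_def split_def)
    then show ?thesis unfolding row_entries_image sum.reindex[OF inj] by (simp add: sum_distrib_left)
  qed
  then show ?thesis using T U row by simp
qed

definition column_increasing :: "(nat \<Rightarrow> nat) \<Rightarrow> (nat \<times> nat \<Rightarrow> nat) \<Rightarrow> bool" where
  "column_increasing \<alpha> T \<longleftrightarrow>
     (\<forall>i i' j. i < i' \<and> (i', j) \<in> diagram \<alpha> \<longrightarrow> T (i, j) < T (i', j))"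

text \<open>Injectivity of \<open>T\<close> leaves every cell other than \<open>c\<close> and
  \<open>c'\<close> untouched. The statement is over the integers because either factor may be
  negative.\<close>

lemma potential_transpose:
  fixes w :: "nat \<times> nat \<Rightarrow> nat"
  assumes \<alpha>: "is_partition \<alpha>" and T: "T \<in> tableaux \<alpha>"
    and c: "c \<in> diagram \<alpha>" "c' \<in> diagram \<alpha>"
  shows "int (potential w \<alpha> (perm_tableau \<alpha> (transpose (T c) (T c')) T))
    = int (potential w \<alpha> T) + (int (w c') - int (w c)) * (int (T c) - int (T c'))"
proof (cases "c = c'")
  case True
  then show ?thesis by (simp add: potential_def cong: sum.cong)
next
  case False
  let ?U = "perm_tableau \<alpha> (transpose (T c) (T c')) T"
  have split: "(\<Sum>x\<in>diagram \<alpha>. f x) = f c + f c' + (\<Sum>x\<in>diagram \<alpha> - {c} - {c'}. f x)" for f :: "_ \<Rightarrow> nat"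
    using sum.remove[OF diagram_finite[OF \<alpha>] c(1), of f]
      sum.remove[of "diagram \<alpha> - {c}" c' f] diagram_finite[OF \<alpha>] c(2) False by simp
  have "?U x = T x" if x: "x \<in> diagram \<alpha> - {c} - {c'}" for x
  proof -
    have "T x \<noteq> T c" "T x \<noteq> T c'"
      using x tableau_inj[OF T _ c(1), of x] tableau_inj[OF T _ c(2), of x] by auto
    then show ?thesis using x by (simp add: transpose_apply_other)
  qed
  then have "(\<Sum>x\<in>diagram \<alpha> - {c} - {c'}. w x * ?U x) = (\<Sum>x\<in>diagram \<alpha> - {c} - {c'}. w x * T x)"
    by (intro sum.cong) auto
  then show ?thesis unfolding potential_def split using c by (simp add: algebra_simps)
qed

lemma column_transpose:
  assumes T: "T \<in> tableaux \<alpha>" and c: "(i, j) \<in> diagram \<alpha>" "(i', j) \<in> diagram \<alpha>"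
  shows "transpose (T (i, j)) (T (i', j)) \<in> column_stabilizer \<alpha> T"
proof -
  have "transpose (T (i, j)) (T (i', j)) ` column_entries \<alpha> T k = column_entries \<alpha> T k" for k
  proof -
    have "T (i, j) \<in> column_entries \<alpha> T k \<longleftrightarrow> k = j" "T (i', j) \<in> column_entries \<alpha> T k \<longleftrightarrow> k = j"
      using tableau_inj[OF T c(1)] tableau_inj[OF T c(2)] c by (auto simp: column_entries_def)
    then show ?thesis by (cases "k = j") (auto simp: transpose_def image_iff)
  qed
  then show ?thesis unfolding column_stabilizer_def
    using bij_betw_apply[OF tableau_bij[OF T]] c by (auto intro!: permutes_swap_id)
qed

text \<open>Swapping two entries in the wrong order moves the larger one to the lower row, which
  raises the \<open>fst\<close> potential; the two cells share a column, so \<open>snd\<close> gives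
  them equal weight.\<close>

lemma column_descent:
  assumes \<alpha>: "is_partition \<alpha>" and T: "T \<in> tableaux \<alpha>" and "\<not> column_increasing \<alpha> T"
  obtains \<tau> where "\<tau> \<in> column_stabilizer \<alpha> T" "sign \<tau> = -1"
    "potential fst \<alpha> T < potential fst \<alpha> (perm_tableau \<alpha> \<tau> T)"
    "potential snd \<alpha> (perm_tableau \<alpha> \<tau> T) = potential snd \<alpha> T"
proof -
  obtain i i' j where c: "i < i'" "(i', j) \<in> diagram \<alpha>" "\<not> T (i, j) < T (i', j)"
    using assms(3) by (auto simp: column_increasing_def)
  have c': "(i, j) \<in> diagram \<alpha>" using diagram_down[OF \<alpha> c(2)] c(1) by simp
  have "T (i, j) \<noteq> T (i', j)" using tableau_inj[OF T c(2) c'] c(1) by auto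
  then have gt: "T (i', j) < T (i, j)" using c(3) by simp
  then have "0 < (int i' - int i) * (int (T (i, j)) - int (T (i', j)))" using c(1) by simp
  then show ?thesis
    using that[OF column_transpose[OF T c' c(2)]] potential_transpose[OF \<alpha> T c' c(2), of fst]
      potential_transpose[OF \<alpha> T c' c(2), of snd] gt by (simp add: sign_swap_id)
qed

section \<open>The column-increasing tableau as the unique maximiser in its column orbit\<close>

lemma increasing_image_eq:
  fixes f g :: "nat \<Rightarrow> nat"
  assumes "strict_mono_on {..<h} f" "strict_mono_on {..<h} g" "f ` {..<h} = g ` {..<h}" "i < h"
  shows "f i = g i"
proof -
  have "sorted_wrt (<) (map f [0..<h])" if "strict_mono_on {..<h} f" for f :: "nat \<Rightarrow> nat"
    using that by (auto simp: sorted_wrt_map sorted_wrt_iff_nth_less strict_mono_on_def)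
  then have "map f [0..<h] = map g [0..<h]"
    using assms by (intro strict_sorted_equal) (auto simp: atLeast0LessThan)
  then show ?thesis using assms(4) by (metis diff_zero length_map length_upt nth_map nth_upt add_0)
qed

lemma column_height:
  assumes "is_partition \<alpha>"
  obtains h where "\<And>i. (i, j) \<in> diagram \<alpha> \<longleftrightarrow> i < h"
proof -
  obtain n where "\<forall>i\<ge>n. \<alpha> i = 0" using partition_bound[OF assms] .
  then have "\<alpha> n \<le> j" by simp
  then have ex: "\<exists>i. \<alpha> i \<le> j" ..
  define h where "h = (LEAST i. \<alpha> i \<le> j)"
  have "\<alpha> h \<le> j" unfolding h_def using ex by (rule LeastI_ex)
  then have "(i, j) \<in> diagram \<alpha> \<longleftrightarrow> i < h" for i
    using not_less_Least[of i "\<lambda>i. \<alpha> i \<le> j"] partitionD[OF assms, of h i]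
    by (cases "i < h") (auto simp: diagram_def h_def)
  then show ?thesis by (rule that)
qed

lemma column_increasing_unique:
  assumes \<alpha>: "is_partition \<alpha>" and T: "T \<in> tableaux \<alpha>" "column_increasing \<alpha> T"
    and U: "U \<in> tableaux \<alpha>" "column_increasing \<alpha> U"
    and col: "\<And>j. column_entries \<alpha> T j = column_entries \<alpha> U j"
  shows "T = U"
proof (rule tableau_eqI[OF T(1) U(1)])
  fix c assume c: "c \<in> diagram \<alpha>"
  obtain i j where ij: "c = (i, j)" by (cases c)
  obtain h where h: "\<And>i. (i, j) \<in> diagram \<alpha> \<longleftrightarrow> i < h" using column_height[OF \<alpha>] by blast
  have "column_entries \<alpha> S j = (\<lambda>i. S (i, j)) ` {..<h}" for S
    using h by (auto simp: column_entries_def)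
  then have "T (i, j) = U (i, j)"
    using T(2) U(2) col[of j] c h
    by (intro increasing_image_eq[of h "\<lambda>i. T (i, j)" "\<lambda>i. U (i, j)"])
      (auto simp: strict_mono_on_def column_increasing_def ij)
  then show "T c = U c" by (simp add: ij)
qed

lemma standard_column_increasing: "T \<in> standard_tableaux \<alpha> \<Longrightarrow> column_increasing \<alpha> T"
  by (simp add: standard_tableaux_def column_increasing_def)

text \<open>Rows of a standard tableau are increasing enumerations of their sets. Hence distinct
  standard tableaux have distinct tabloids, which can index a triangular system.\<close>

lemma standard_row_unique:
  assumes T: "T \<in> standard_tableaux \<alpha>" and U: "U \<in> standard_tableaux \<alpha>"
    and row: "\<And>i. row_entries \<alpha> T i = row_entries \<alpha> U i"
  shows "T = U"
proof -
  have "T c = U c" if c: "c \<in> diagram \<alpha>" for c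
  proof -
    obtain i j where ij: "c = (i, j)" by (cases c)
    have "T (i, j) = U (i, j)"
      using T U row[of i] c unfolding row_entries_image
      by (intro increasing_image_eq[of "\<alpha> i" "\<lambda>j. T (i, j)" "\<lambda>j. U (i, j)"])
        (auto simp: strict_mono_on_def standard_tableaux_def ij diagram_def)
    then show ?thesis by (simp add: ij)
  qed
  then show ?thesis using T U standard_subset by (intro tableau_eqI) auto
qed

text \<open>A maximiser among the finitely many tableaux with the column sets of \<open>T\<close>
  admits no column descent, so it is column-increasing and is therefore \<open>T\<close>.\<close>

lemma potential_fst_max:
  assumes \<alpha>: "is_partition \<alpha>" and T: "T \<in> tableaux \<alpha>" "column_increasing \<alpha> T"
    and U: "U \<in> tableaux \<alpha>" and col: "\<And>j. column_entries \<alpha> U j = column_entries \<alpha> T j"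
  shows "potential fst \<alpha> U < potential fst \<alpha> T \<or> U = T"
proof -
  define Orb where "Orb = {U \<in> tableaux \<alpha>. \<forall>j. column_entries \<alpha> U j = column_entries \<alpha> T j}"
  have "finite Orb" using finite_tableaux[OF \<alpha>] by (simp add: Orb_def)
  have max: "V = T" if V: "V \<in> Orb" "\<forall>W\<in>Orb. potential fst \<alpha> W \<le> potential fst \<alpha> V" for V
  proof -
    have V': "V \<in> tableaux \<alpha>" "\<And>j. column_entries \<alpha> V j = column_entries \<alpha> T j"
      using V by (auto simp: Orb_def)
    have "column_increasing \<alpha> V"
    proof (rule ccontr)
      assume "\<not> column_increasing \<alpha> V"
      from column_descent[OF \<alpha> V'(1) this]
      obtain \<tau> where \<tau>: "\<tau> \<in> column_stabilizer \<alpha> V"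
        "potential fst \<alpha> V < potential fst \<alpha> (perm_tableau \<alpha> \<tau> V)" by blast
      then have "perm_tableau \<alpha> \<tau> V \<in> Orb"
        using V' perm_tableau_in[OF V'(1)]
        by (simp add: Orb_def column_entries_perm column_stabilizer_def)
      with V(2) have "potential fst \<alpha> (perm_tableau \<alpha> \<tau> V) \<le> potential fst \<alpha> V" by blast
      then show False using \<tau>(2) by simp
    qed
    then show ?thesis using column_increasing_unique[OF \<alpha> V'(1) _ T] V'(2) by blast
  qed
  have "Orb \<noteq> {}" "U \<in> Orb" using U col by (auto simp: Orb_def)
  define m where "m = Max (potential fst \<alpha> ` Orb)"
  have m: "potential fst \<alpha> W \<le> m" if "W \<in> Orb" for W
    using \<open>finite Orb\<close> that by (simp add: m_def)
  have "m \<in> potential fst \<alpha> ` Orb"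
    unfolding m_def using \<open>finite Orb\<close> \<open>Orb \<noteq> {}\<close> by (intro Max_in) auto
  then obtain V where "V \<in> Orb" "m = potential fst \<alpha> V" by auto
  then have "m = potential fst \<alpha> T" using max[of V] m by auto
  \<comment> \<open>A tableau not strictly below the maximum attains it and is a maximiser
    itself.\<close>
  have "U = T" if "\<not> potential fst \<alpha> U < potential fst \<alpha> T"
  proof -
    have "m \<le> potential fst \<alpha> U" using that \<open>m = potential fst \<alpha> T\<close> by simp
    then show ?thesis using m by (intro max[OF \<open>U \<in> Orb\<close>]) (meson order_trans)
  qed
  then show ?thesis by blast
qed

text \<open>Every tabloid that occurs comes from a column permutation of \<open>T\<close>, and its
  \<open>fst\<close> potential does not depend on the chosen representative.\<close>

lemma polytabloid_support:
  assumes \<alpha>: "is_partition \<alpha>" and T: "T \<in> tableaux \<alpha>" "column_increasing \<alpha> T"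
    and U: "U \<in> tableaux \<alpha>" and nz: "polytabloid \<alpha> T (tabloid \<alpha> U) \<noteq> 0"
  shows "potential fst \<alpha> U < potential fst \<alpha> T \<or> tabloid \<alpha> U = tabloid \<alpha> T"
proof -
  obtain \<pi> where "\<pi> \<in> column_stabilizer \<alpha> T"
    "(of_int (sign \<pi>) * of_bool (tabloid \<alpha> U = tabloid \<alpha> (perm_tableau \<alpha> \<pi> T)) :: complex) \<noteq> 0"
    using nz unfolding polytabloid_def by (rule sum.not_neutral_contains_not_neutral)
  then have \<pi>: "\<pi> \<in> column_stabilizer \<alpha> T" "tabloid \<alpha> U = tabloid \<alpha> (perm_tableau \<alpha> \<pi> T)"
    by simp_all
  have tab: "perm_tableau \<alpha> \<pi> T \<in> tableaux \<alpha>"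
    by (rule perm_tableau_in[OF T(1) column_stabilizer_permutes[OF \<pi>(1)]])
  have "potential fst \<alpha> U = potential fst \<alpha> (perm_tableau \<alpha> \<pi> T)"
    using potential_fst_cong[OF \<alpha> U tab tabloid_eqD[OF \<pi>(2) U]] .
  moreover have "potential fst \<alpha> (perm_tableau \<alpha> \<pi> T) < potential fst \<alpha> T \<or> perm_tableau \<alpha> \<pi> T = T"
    by (rule potential_fst_max[OF \<alpha> T tab column_entries_column_perm[OF \<pi>(1)]])
  ultimately show ?thesis using \<pi>(2) by metis
qed

text \<open>A column permutation fixing the tabloid of \<open>T\<close> keeps the potential, so by
  uniqueness of the maximiser it fixes \<open>T\<close> and is the identity: a single term
  survives.\<close>

lemma polytabloid_self:
  assumes \<alpha>: "is_partition \<alpha>" and T: "T \<in> tableaux \<alpha>" "column_increasing \<alpha> T"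
  shows "polytabloid \<alpha> T (tabloid \<alpha> T) = 1"
proof -
  have id: "\<pi> = id" if \<pi>: "\<pi> \<in> column_stabilizer \<alpha> T" "tabloid \<alpha> T = tabloid \<alpha> (perm_tableau \<alpha> \<pi> T)" for \<pi>
  proof -
    have p: "\<pi> permutes {1..weight \<alpha>}" using \<pi>(1) by (rule column_stabilizer_permutes)
    note tab = perm_tableau_in[OF T(1) p]
    have "potential fst \<alpha> T = potential fst \<alpha> (perm_tableau \<alpha> \<pi> T)"
      by (rule potential_fst_cong[OF \<alpha> T(1) tab tabloid_eqD[OF \<pi>(2) T(1)]])
    then have eq: "perm_tableau \<alpha> \<pi> T = T"
      using potential_fst_max[OF \<alpha> T tab column_entries_column_perm[OF \<pi>(1)]] by simp
    show ?thesis
    proof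
      fix k
      show "\<pi> k = id k"
      proof (cases "k \<in> {1..weight \<alpha>}")
        case True
        then obtain c where "c \<in> diagram \<alpha>" "T c = k"
          using tableau_bij[OF T(1)] by (metis bij_betw_def imageE)
        then show ?thesis using eq by (metis id_apply perm_tableau_apply)
      next
        case False
        then show ?thesis using p by (simp add: permutes_not_in)
      qed
    qed
  qed
  have "perm_tableau \<alpha> id T = T"
    using T by (auto simp: perm_tableau_def tableaux_def extensional_restrict)
  moreover have "id \<in> column_stabilizer \<alpha> T" by (auto simp: column_stabilizer_def permutes_id)
  ultimately have "polytabloid \<alpha> T (tabloid \<alpha> T) = (\<Sum>\<pi>\<in>{id}. of_int (sign \<pi>) *
     of_bool (tabloid \<alpha> T = tabloid \<alpha> (perm_tableau \<alpha> \<pi> T)))"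
    unfolding polytabloid_def using id by (intro sum.mono_neutral_right) auto
  then show ?thesis using \<open>perm_tableau \<alpha> id T = T\<close> by simp
qed

lemma standard_polytabloid_self:
  assumes "is_partition \<alpha>" "T \<in> standard_tableaux \<alpha>"
  shows "polytabloid \<alpha> T (tabloid \<alpha> T) = 1"
  using polytabloid_self[OF assms(1)] standard_column_increasing[OF assms(2)] assms(2) standard_subset
  by blast

lemma sum_fun_apply: "(\<Sum>a\<in>A. f a) x = (\<Sum>a\<in>A. f a x)"
  by (induction A rule: infinite_finite_induct) auto

section \<open>Unitriangularity of the standard polytabloids\<close>

lemma standard_unitriangular:
  assumes \<alpha>: "is_partition \<alpha>" and T: "T \<in> standard_tableaux \<alpha>" and U: "U \<in> standard_tableaux \<alpha>"
    and "polytabloid \<alpha> T (tabloid \<alpha> U) \<noteq> 0"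
  shows "potential fst \<alpha> U < potential fst \<alpha> T \<or> U = T"
proof -
  have "T \<in> tableaux \<alpha>" "U \<in> tableaux \<alpha>" using T U standard_subset by auto
  then show ?thesis
    using polytabloid_support[OF \<alpha> _ standard_column_increasing[OF T]] assms(4)
      standard_row_unique[OF U T] tabloid_eqD by blast
qed

text \<open>If two standard tableaux shared a polytabloid, the tabloid of each would occur in that
  of the other, and the two strict inequalities between their potentials exclude each other.\<close>

lemma inj_on_polytabloid:
  assumes \<alpha>: "is_partition \<alpha>"
  shows "inj_on (polytabloid \<alpha>) (standard_tableaux \<alpha>)"
proof (rule inj_onI)
  fix T U assume TU: "T \<in> standard_tableaux \<alpha>" "U \<in> standard_tableaux \<alpha>" "polytabloid \<alpha> T = polytabloid \<alpha> U"
  then have "polytabloid \<alpha> T (tabloid \<alpha> U) \<noteq> 0" "polytabloid \<alpha> U (tabloid \<alpha> T) \<noteq> 0"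
    using standard_polytabloid_self[OF \<alpha> TU(1)] standard_polytabloid_self[OF \<alpha> TU(2)] by simp_all
  then show "T = U"
    using standard_unitriangular[OF \<alpha> TU(1,2)] standard_unitriangular[OF \<alpha> TU(2,1)] by auto
qed

text \<open>In a vanishing combination, take a tableau of largest potential among those with nonzero
  coefficient. Its tabloid occurs in no other polytabloid with nonzero coefficient, so evaluation
  there isolates its coefficient.\<close>

lemma independent_polytabloids:
  assumes \<alpha>: "is_partition \<alpha>"
  shows "complex_fun.independent (polytabloid \<alpha> ` standard_tableaux \<alpha>)"
proof -
  let ?S = "standard_tableaux \<alpha>"
  have fin: "finite ?S" using finite_subset[OF standard_subset finite_tableaux[OF \<alpha>]] .
  have False if u: "(\<Sum>v\<in>polytabloid \<alpha> ` ?S. (\<lambda>x. u v * v x)) = 0"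
    and nz: "\<exists>v\<in>polytabloid \<alpha> ` ?S. u v \<noteq> 0" for u :: "_ \<Rightarrow> complex"
  proof -
    define N where "N = {T \<in> ?S. u (polytabloid \<alpha> T) \<noteq> 0}"
    have N: "finite N" "N \<noteq> {}" using fin nz by (auto simp: N_def)
    then have "Max (potential fst \<alpha> ` N) \<in> potential fst \<alpha> ` N" by (intro Max_in) auto
    then obtain T where T: "T \<in> N" "potential fst \<alpha> T = Max (potential fst \<alpha> ` N)" by auto
    have zero: "u (polytabloid \<alpha> U) * polytabloid \<alpha> U (tabloid \<alpha> T) = 0" if U: "U \<in> ?S" "U \<noteq> T" for U
    proof (cases "U \<in> N")
      case True
      then have "potential fst \<alpha> U \<le> potential fst \<alpha> T" using T(2) N(1) by simp
      then show ?thesis using standard_unitriangular[OF \<alpha> U(1)] T(1) U(2) by (force simp: N_def)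
    qed (use U in \<open>simp add: N_def\<close>)
    have "0 = (\<Sum>v\<in>polytabloid \<alpha> ` ?S. (\<lambda>x. u v * v x)) (tabloid \<alpha> T)" using u by simp
    also have "\<dots> = (\<Sum>U\<in>?S. u (polytabloid \<alpha> U) * polytabloid \<alpha> U (tabloid \<alpha> T))"
      by (simp add: sum_fun_apply sum.reindex[OF inj_on_polytabloid[OF \<alpha>]])
    also have "\<dots> = (\<Sum>U\<in>{T}. u (polytabloid \<alpha> U) * polytabloid \<alpha> U (tabloid \<alpha> T))"
      using fin zero T(1) by (intro sum.mono_neutral_right) (auto simp: N_def)
    also have "\<dots> = u (polytabloid \<alpha> T)"
      using standard_polytabloid_self[OF \<alpha>] T(1) by (simp add: N_def)
    finally show False using T(1) by (simp add: N_def)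
  qed
  then show ?thesis using fin by (auto simp: complex_fun.dependent_finite)
qed

subsection \<open>Garnir relations and spanning\<close>

lemma row_entries_unique:
  assumes "T \<in> tableaux \<alpha>" "k \<in> row_entries \<alpha> T i" "k \<in> row_entries \<alpha> T i'"
  shows "i = i'"
proof -
  obtain j j' where "(i, j) \<in> diagram \<alpha>" "(i', j') \<in> diagram \<alpha>" "T (i, j) = k" "T (i', j') = k"
    using assms(2,3) by (auto simp: row_entries_def)
  then show ?thesis using tableau_inj[OF assms(1), of "(i, j)" "(i', j')"] by simp
qed

text \<open>The transposition acts before \<sigma> and exchanges two entries of one row of
  \<open>U\<close>, so \<sigma> receives the same row sets.\<close>

lemma tabloid_row_transpose:
  assumes U: "U \<in> tableaux \<alpha>" and ab: "a \<in> row_entries \<alpha> U i" "b \<in> row_entries \<alpha> U i"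
  shows "tabloid \<alpha> (perm_tableau \<alpha> (\<sigma> \<circ> transpose a b) U) = tabloid \<alpha> (perm_tableau \<alpha> \<sigma> U)"
proof (rule tabloid_cong)
  fix r
  have "a \<in> row_entries \<alpha> U r \<longleftrightarrow> b \<in> row_entries \<alpha> U r"
    using row_entries_unique[OF U ab(1), of r] row_entries_unique[OF U ab(2), of r] ab by blast
  then have "transpose a b ` row_entries \<alpha> U r = row_entries \<alpha> U r"
    by (auto simp: transpose_def image_iff)
  moreover have "(\<sigma> \<circ> transpose a b) ` row_entries \<alpha> U r = \<sigma> ` transpose a b ` row_entries \<alpha> U r"
    by (simp only: image_comp)
  ultimately show "row_entries \<alpha> (perm_tableau \<alpha> (\<sigma> \<circ> transpose a b) U) r
      = row_entries \<alpha> (perm_tableau \<alpha> \<sigma> U) r"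
    by (simp only: row_entries_perm)
qed

text \<open>For fixed \<pi>, composing \<sigma> with the transposition of two entries of
  \<open>X\<close> in one row of \<open>perm_tableau \<alpha> \<pi> T\<close> is a sign-reversing
  involution that keeps the tabloid. The pair depends on \<pi>, which is why the sum over \<pi> is
  moved outside.\<close>

lemma antisymmetrised_polytabloid_eq_0:
  assumes T: "T \<in> tableaux \<alpha>" and X: "X \<subseteq> {1..weight \<alpha>}"
    and row: "\<And>\<pi>. \<pi> \<in> column_stabilizer \<alpha> T \<Longrightarrow>
      \<exists>a\<in>X. \<exists>b\<in>X. a \<noteq> b \<and> (\<exists>i. a \<in> row_entries \<alpha> (perm_tableau \<alpha> \<pi> T) i
        \<and> b \<in> row_entries \<alpha> (perm_tableau \<alpha> \<pi> T) i)"
  shows "(\<Sum>\<sigma> | \<sigma> permutes X. of_int (sign \<sigma>) * polytabloid \<alpha> (perm_tableau \<alpha> \<sigma> T) Y) = 0"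
proof -
  let ?f = "\<lambda>\<sigma> \<pi>. of_bool (Y = tabloid \<alpha> (perm_tableau \<alpha> (\<sigma> \<circ> \<pi>) T)) :: complex"
  have zero: "(\<Sum>\<sigma> | \<sigma> permutes X. of_int (sign \<sigma>) * ?f \<sigma> \<pi>) = 0"
    if \<pi>: "\<pi> \<in> column_stabilizer \<alpha> T" for \<pi>
  proof -
    obtain a b i where ab: "a \<in> X" "b \<in> X" "a \<noteq> b"
      "a \<in> row_entries \<alpha> (perm_tableau \<alpha> \<pi> T) i" "b \<in> row_entries \<alpha> (perm_tableau \<alpha> \<pi> T) i"
      using row[OF \<pi>] by blast
    let ?t = "transpose a b"
    note U = perm_tableau_in[OF T column_stabilizer_permutes[OF \<pi>]]
    have f: "?f (\<sigma> \<circ> ?t) \<pi> = ?f \<sigma> \<pi>" for \<sigma>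
      using tabloid_row_transpose[OF U ab(4,5), of \<sigma>] by (simp only: perm_tableau_comp)
    have t: "?t permutes X" using ab by (simp add: permutes_swap_id)
    have fin: "finite X" using X finite_subset by blast
    have s: "sign (\<sigma> \<circ> ?t) = - sign \<sigma>" if "\<sigma> permutes X" for \<sigma>
      using sign_compose[of \<sigma> ?t] permutation_permutes that t fin ab(3)
      by (metis mult_minus1_right sign_swap_id)
    have "(\<Sum>\<sigma> | \<sigma> permutes X. of_int (sign \<sigma>) * ?f \<sigma> \<pi>)
        = (\<Sum>\<sigma> | \<sigma> permutes X. of_int (sign (\<sigma> \<circ> ?t)) * ?f (\<sigma> \<circ> ?t) \<pi>)"
      by (rule sum.reindex_bij_witness[where i = "\<lambda>\<sigma>. \<sigma> \<circ> ?t" and j = "\<lambda>\<sigma>. \<sigma> \<circ> ?t"])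
        (auto simp: comp_assoc permutes_compose[OF t])
    also have "\<dots> = - (\<Sum>\<sigma> | \<sigma> permutes X. of_int (sign \<sigma>) * ?f \<sigma> \<pi>)"
      unfolding sum_negf[symmetric] by (rule sum.cong) (simp_all only: mem_Collect_eq f s of_int_minus mult_minus_left)
    finally show ?thesis by simp
  qed
  have "(\<Sum>\<sigma> | \<sigma> permutes X. of_int (sign \<sigma>) * polytabloid \<alpha> (perm_tableau \<alpha> \<sigma> T) Y)
    = (\<Sum>\<sigma> | \<sigma> permutes X. \<Sum>\<pi>\<in>column_stabilizer \<alpha> T. of_int (sign \<pi>) * (of_int (sign \<sigma>) * ?f \<sigma> \<pi>))"
    using polytabloid_perm[of _ \<alpha> T Y] permutes_subset[OF _ X]
    by (intro sum.cong refl) (simp only: mem_Collect_eq sum_distrib_left mult.left_commute)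
  also have "\<dots> = (\<Sum>\<pi>\<in>column_stabilizer \<alpha> T. of_int (sign \<pi>) * (\<Sum>\<sigma> | \<sigma> permutes X. of_int (sign \<sigma>) * ?f \<sigma> \<pi>))"
    unfolding sum_distrib_left by (rule sum.swap)
  also have "\<dots> = 0" using zero by simp
  finally show ?thesis .
qed

text \<open>As many elements enter as leave; those entering are at least \<open>t\<close> and those
  leaving are below it. In the Garnir relation, \<open>S\<close> is the image of \<open>B\<close>
  under a permutation.\<close>

lemma sum_less_exchange:
  fixes B S :: "nat set"
  assumes "finite B" "finite S" "card S = card B" "S \<noteq> B"
    and "\<And>k. k \<in> S - B \<Longrightarrow> t \<le> k" "\<And>k. k \<in> B \<Longrightarrow> k < t"
  shows "\<Sum>B < \<Sum>S"
proof -
  have card: "card (S - B) = card (B - S)"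
    using card_Diff_subset_Int[of S B] card_Diff_subset_Int[of B S] assms by (simp add: Int_commute)
  have "B - S \<noteq> {}"
    using assms card by (metis Diff_eq_empty_iff card_subset_eq)
  then have "\<Sum>(B - S) < (\<Sum>k\<in>B - S. t)" using assms by (intro sum_strict_mono) auto
  also have "\<dots> = (\<Sum>k\<in>S - B. t)" using card by simp
  also have "\<dots> \<le> \<Sum>(S - B)" using assms by (intro sum_mono) auto
  finally show ?thesis
    using sum.Int_Diff[OF assms(1), of "\<lambda>k. k" S] sum.Int_Diff[OF assms(2), of "\<lambda>k. k" B]
    by (simp add: Int_commute)
qed

text \<open>\<open>X\<close> consists of the entries of column \<open>j\<close> weakly below row \<open>i\<close> and of those of column
  \<open>j'\<close> weakly above it: one more than the length of column \<open>j\<close>, so every column permutation of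
  \<open>T\<close> puts two of them in one row. Antisymmetrising over all permutations of \<open>X\<close>, rather than
  over coset representatives, costs nothing in characteristic 0.\<close>

lemma garnir:
  assumes \<alpha>: "is_partition \<alpha>" and T: "T \<in> tableaux \<alpha>" "column_increasing \<alpha> T"
    and j: "j < j'" and c': "(i, j') \<in> diagram \<alpha>" and descent: "T (i, j') < T (i, j)"
  obtains X where "finite X" "\<And>\<sigma>. \<sigma> permutes X \<Longrightarrow> \<sigma> permutes {1..weight \<alpha>}"
    "\<And>Y. (\<Sum>\<sigma> | \<sigma> permutes X. of_int (sign \<sigma>) * polytabloid \<alpha> (perm_tableau \<alpha> \<sigma> T) Y) = 0"
    "\<And>\<sigma>. \<sigma> permutes X \<Longrightarrow> \<sigma> \<notin> column_stabilizer \<alpha> T \<Longrightarrow>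
      potential snd \<alpha> T < potential snd \<alpha> (perm_tableau \<alpha> \<sigma> T)"
proof -
  obtain h where h: "\<And>r. (r, j) \<in> diagram \<alpha> \<longleftrightarrow> r < h" using column_height[OF \<alpha>] by blast
  \<comment> \<open>Column \<open>j'\<close> lies to the right of column \<open>j\<close>, so it
    reaches no further down.\<close>
  have left: "(r, j') \<in> diagram \<alpha> \<Longrightarrow> r < h" for r
    using diagram_down[OF \<alpha>, of r j' r j] j h by simp
  have i: "i < h" using left[OF c'] .
  have up: "r \<le> i \<Longrightarrow> (r, j') \<in> diagram \<alpha>" for r using diagram_down[OF \<alpha> c', of r j'] by simp
  define P where "P = (\<lambda>r. (r, j)) ` {i..<h}"
  define Q where "Q = (\<lambda>r. (r, j')) ` {..i}"
  have PQ: "P \<subseteq> diagram \<alpha>" "Q \<subseteq> diagram \<alpha>" "P \<inter> Q = {}" "finite P" "finite Q"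
    using h up j by (auto simp: P_def Q_def)
  note injT = bij_betw_imp_inj_on[OF tableau_bij[OF T(1)]]
  note injP = inj_on_subset[OF injT PQ(1)] and injQ = inj_on_subset[OF injT PQ(2)]
  define A where "A = T ` P"
  define B where "B = T ` Q"
  have fin: "finite A" "finite B" using PQ by (auto simp: A_def B_def)
  have disj: "A \<inter> B = {}"
    using inj_on_image_Int[OF injT PQ(1,2)] PQ(3) by (simp add: A_def B_def)
  \<comment> \<open>The row descent separates the two halves: since columns increase,
    \<open>T (i, j)\<close> is the least entry of \<open>A\<close> and exceeds every entry of
    \<open>B\<close>.\<close>
  have A: "T (i, j) \<le> k" if k: "k \<in> A" for k
  proof -
    obtain r where r: "i \<le> r" "r < h" "k = T (r, j)" using k by (auto simp: A_def P_def)
    then show ?thesis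
      using T(2) h by (cases "r = i") (auto simp: column_increasing_def intro!: less_imp_le)
  qed
  have B: "k < T (i, j)" if k: "k \<in> B" for k
  proof -
    obtain r where r: "r \<le> i" "k = T (r, j')" using k by (auto simp: B_def Q_def)
    then have "k \<le> T (i, j')"
      using T(2) c' by (cases "r = i") (auto simp: column_increasing_def intro!: less_imp_le)
    then show ?thesis using descent by simp
  qed
  have sub: "A \<union> B \<subseteq> {1..weight \<alpha>}"
    using PQ(1,2) bij_betw_imp_surj_on[OF tableau_bij[OF T(1)]] by (auto simp: A_def B_def)
  \<comment> \<open>Column \<open>j\<close> contributes \<open>h - i\<close> entries and column
    \<open>j'\<close> contributes \<open>i + 1\<close>.\<close>
  have cardX: "card (A \<union> B) = Suc h"
    using card_Un_disjoint[OF fin disj] card_image[OF injP] card_image[OF injQ] i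
    by (simp add: A_def B_def P_def Q_def card_image inj_on_def)
  have same_row: "\<exists>a\<in>A \<union> B. \<exists>b\<in>A \<union> B. a \<noteq> b \<and>
      (\<exists>r. a \<in> row_entries \<alpha> (perm_tableau \<alpha> \<pi> T) r \<and> b \<in> row_entries \<alpha> (perm_tableau \<alpha> \<pi> T) r)"
    if \<pi>: "\<pi> \<in> column_stabilizer \<alpha> T" for \<pi>
  proof -
    let ?U = "perm_tableau \<alpha> \<pi> T"
    have "\<exists>r<h. k \<in> row_entries \<alpha> ?U r" if k: "k \<in> A \<union> B" for k
    proof -
      have "k \<in> column_entries \<alpha> T j \<or> k \<in> column_entries \<alpha> T j'"
        using k PQ(1,2) by (auto simp: A_def B_def P_def Q_def column_entries_def)
      then have "k \<in> column_entries \<alpha> ?U j \<or> k \<in> column_entries \<alpha> ?U j'"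
        by (simp only: column_entries_column_perm[OF \<pi>])
      then obtain r l where "(r, l) \<in> diagram \<alpha>" "l = j \<or> l = j'" "k = ?U (r, l)"
        unfolding column_entries_def by blast
      then show ?thesis using h left unfolding row_entries_def by blast
    qed
    then obtain f where f: "\<And>k. k \<in> A \<union> B \<Longrightarrow> f k < h \<and> k \<in> row_entries \<alpha> ?U (f k)" by metis
    then have "card (f ` (A \<union> B)) \<le> card {..<h}" by (intro card_mono) auto
    then have "\<not> inj_on f (A \<union> B)" using cardX by (intro pigeonhole) simp
    then obtain a b where "a \<in> A \<union> B" "b \<in> A \<union> B" "a \<noteq> b" "f a = f b" unfolding inj_on_def by blast
    then show ?thesis using f by metis
  qed
  \<comment> \<open>As \<sigma> keeps the sum over \<open>A \<union> B\<close>, what the cells of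
    \<open>Q\<close> gain the cells of \<open>P\<close> lose. The potential thus changes by
    \<open>j' - j\<close> times the gain on \<open>B\<close>, which is positive because \<sigma>
    trades entries of \<open>B\<close> for larger ones from \<open>A\<close>.\<close>
  have pot: "potential snd \<alpha> T < potential snd \<alpha> (perm_tableau \<alpha> \<sigma> T)"
    if \<sigma>: "\<sigma> permutes A \<union> B" and ne: "\<sigma> ` B \<noteq> B" for \<sigma>
  proof -
    let ?g = "\<lambda>k. int (\<sigma> k) - int k"
    have "int (potential snd \<alpha> (perm_tableau \<alpha> \<sigma> T)) - int (potential snd \<alpha> T)
        = (\<Sum>c\<in>diagram \<alpha>. int (snd c) * ?g (T c))"
      by (simp add: potential_def sum_subtractf[symmetric] right_diff_distrib)
    also have "\<dots> = (\<Sum>c\<in>P \<union> Q. int (snd c) * ?g (T c))"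
    proof (rule sum.mono_neutral_right)
      show "\<forall>c\<in>diagram \<alpha> - (P \<union> Q). int (snd c) * ?g (T c) = 0"
      proof
        fix c assume c: "c \<in> diagram \<alpha> - (P \<union> Q)"
        then have "T c \<notin> A \<union> B"
          using inj_on_image_mem_iff[OF injT, of c P] inj_on_image_mem_iff[OF injT, of c Q] PQ
          by (auto simp: A_def B_def)
        then show "int (snd c) * ?g (T c) = 0" using \<sigma> by (simp add: permutes_not_in)
      qed
    qed (use PQ diagram_finite[OF \<alpha>] in auto)
    also have "\<dots> = (\<Sum>c\<in>P. int (snd c) * ?g (T c)) + (\<Sum>c\<in>Q. int (snd c) * ?g (T c))"
      using PQ by (intro sum.union_disjoint) auto
    also have "(\<Sum>c\<in>P. int (snd c) * ?g (T c)) = (\<Sum>c\<in>P. int j * ?g (T c))"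
      by (rule sum.cong) (auto simp: P_def)
    also have "\<dots> = int j * (\<Sum>k\<in>A. ?g k)"
      by (simp add: A_def sum.reindex[OF injP] sum_distrib_left)
    also have "(\<Sum>c\<in>Q. int (snd c) * ?g (T c)) = (\<Sum>c\<in>Q. int j' * ?g (T c))"
      by (rule sum.cong) (auto simp: Q_def)
    also have "\<dots> = int j' * (\<Sum>k\<in>B. ?g k)"
      by (simp add: B_def sum.reindex[OF injQ] sum_distrib_left)
    also have "(\<Sum>k\<in>A. ?g k) = - (\<Sum>k\<in>B. ?g k)"
    proof -
      have "(\<Sum>k\<in>A \<union> B. ?g k) = 0"
        using sum.permute[OF \<sigma>, of int] by (simp add: sum_subtractf comp_def)
      then show ?thesis using sum.union_disjoint[OF fin disj, of ?g] by simp
    qed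
    finally have diff: "int (potential snd \<alpha> (perm_tableau \<alpha> \<sigma> T)) - int (potential snd \<alpha> T)
        = (int j' - int j) * (\<Sum>k\<in>B. ?g k)" by (simp add: algebra_simps)
    have inj\<sigma>: "inj_on \<sigma> B" using permutes_inj_on[OF \<sigma>] .
    have "\<Sum>B < \<Sum>(\<sigma> ` B)"
    proof (rule sum_less_exchange[OF fin(2) _ card_image[OF inj\<sigma>] ne])
      show "T (i, j) \<le> k" if "k \<in> \<sigma> ` B - B" for k
        using that permutes_in_image[OF \<sigma>] A by auto
    qed (use fin B in auto)
    then have "int (\<Sum>B) < int (\<Sum>k\<in>B. \<sigma> k)" by (simp only: sum.reindex[OF inj\<sigma>] comp_def of_nat_less_iff)
    then have "(\<Sum>k\<in>B. ?g k) > 0" by (simp add: sum_subtractf)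
    then have "(int j' - int j) * (\<Sum>k\<in>B. ?g k) > 0" using j by simp
    then show ?thesis using diff by linarith
  qed
  \<comment> \<open>A permutation preserving \<open>B\<close> as a set also preserves
    \<open>A\<close>, and then every column; hence \<open>pot\<close> covers each \<sigma> outside
    the column stabilizer.\<close>
  have stab: "\<sigma> \<in> column_stabilizer \<alpha> T" if \<sigma>: "\<sigma> permutes A \<union> B" and B': "\<sigma> ` B = B" for \<sigma>
  proof -
    have "\<sigma> ` A = A"
    proof -
      have "\<sigma> ` (A \<union> B) - \<sigma> ` B = A" using B' disj permutes_image[OF \<sigma>] by auto
      moreover have "\<sigma> ` (A \<union> B) - \<sigma> ` B = \<sigma> ` ((A \<union> B) - B)"
        using image_set_diff[OF permutes_inj[OF \<sigma>]] by metis
      moreover have "(A \<union> B) - B = A" using disj by auto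
      ultimately show ?thesis by simp
    qed
    have "\<sigma> ` column_entries \<alpha> T l = column_entries \<alpha> T l" for l
    proof (rule endo_inj_surj)
      have "column_entries \<alpha> T l \<subseteq> T ` diagram \<alpha>" by (auto simp: column_entries_def)
      then show "finite (column_entries \<alpha> T l)" using diagram_finite[OF \<alpha>] finite_surj by blast
      show "inj_on \<sigma> (column_entries \<alpha> T l)" using permutes_inj_on[OF \<sigma>] .
      show "\<sigma> ` column_entries \<alpha> T l \<subseteq> column_entries \<alpha> T l"
      proof safe
        fix k assume k: "k \<in> column_entries \<alpha> T l"
        have mem: "m \<in> A \<Longrightarrow> m \<in> column_entries \<alpha> T j" "m \<in> B \<Longrightarrow> m \<in> column_entries \<alpha> T j'" for m
          using PQ(1,2) by (auto simp: A_def B_def P_def Q_def column_entries_def)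
        have uniq: "l' = l" if "k \<in> column_entries \<alpha> T l'" for l'
          using that k tableau_inj[OF T(1)] unfolding column_entries_def by blast
        consider "k \<in> A" | "k \<in> B" | "k \<notin> A \<union> B" by blast
        then show "\<sigma> k \<in> column_entries \<alpha> T l"
        proof cases
          case 1
          then show ?thesis using mem(1) uniq \<open>\<sigma> ` A = A\<close> by blast
        next
          case 2
          then show ?thesis using mem(2) uniq B' by blast
        next
          case 3
          then show ?thesis using k \<sigma> by (simp add: permutes_not_in)
        qed
      qed
    qed
    then show ?thesis using permutes_subset[OF \<sigma> sub] by (simp add: column_stabilizer_def)
  qed
  show ?thesis
  proof (rule that[of "A \<union> B"])
    show "finite (A \<union> B)" using fin by simp
    show "\<sigma> permutes {1..weight \<alpha>}" if "\<sigma> permutes A \<union> B" for \<sigma>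
      using permutes_subset[OF that sub] .
    show "(\<Sum>\<sigma> | \<sigma> permutes A \<union> B.
        of_int (sign \<sigma>) * polytabloid \<alpha> (perm_tableau \<alpha> \<sigma> T) Y) = 0" for Y
      by (rule antisymmetrised_polytabloid_eq_0[OF T(1) sub same_row])
    show "potential snd \<alpha> T < potential snd \<alpha> (perm_tableau \<alpha> \<sigma> T)"
      if "\<sigma> permutes A \<union> B" "\<sigma> \<notin> column_stabilizer \<alpha> T" for \<sigma>
      using pot[OF that(1)] stab[OF that(1)] that(2) by blast
  qed
qed

text \<open>The measure \<open>?r\<close> compares \<open>snd\<close> first: repairing a column
  keeps \<open>snd\<close> and raises \<open>fst\<close>, while a Garnir relation raises
  \<open>snd\<close> whatever it does to \<open>fst\<close>.\<close>

lemma polytabloid_in_span: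
  assumes \<alpha>: "is_partition \<alpha>" and "T \<in> tableaux \<alpha>"
  shows "polytabloid \<alpha> T \<in> complex_fun.span (polytabloid \<alpha> ` standard_tableaux \<alpha>)"
    (is "_ \<in> ?V")
proof -
  define M where "M w = (\<Sum>c\<in>diagram \<alpha>. w c * weight \<alpha>)" for w :: "nat \<times> nat \<Rightarrow> nat"
  let ?r = "measures [\<lambda>T. M snd - potential snd \<alpha> T, \<lambda>T. M fst - potential fst \<alpha> T]"
  have bound: "potential w \<alpha> T \<le> M w" if "T \<in> tableaux \<alpha>" for w T
    unfolding M_def by (rule potential_le[OF that])
  have scale: "(\<lambda>Y. c * polytabloid \<alpha> T Y) \<in> ?V" if "polytabloid \<alpha> T \<in> ?V" for c T
    using complex_fun.span_scale[OF that] .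
  have "wf ?r" by simp
  then show ?thesis using assms(2)
  proof (induction T rule: wf_induct_rule)
    case (less T)
    note T = less.prems
    show ?case
    proof (cases "column_increasing \<alpha> T")
      case False
      from column_descent[OF \<alpha> T False] obtain \<tau> where \<tau>: "\<tau> \<in> column_stabilizer \<alpha> T" "sign \<tau> = -1"
        "potential fst \<alpha> T < potential fst \<alpha> (perm_tableau \<alpha> \<tau> T)"
        "potential snd \<alpha> (perm_tableau \<alpha> \<tau> T) = potential snd \<alpha> T" by blast
      note tab = perm_tableau_in[OF T column_stabilizer_permutes[OF \<tau>(1)]]
      have "polytabloid \<alpha> (perm_tableau \<alpha> \<tau> T) \<in> ?V"
        using \<tau>(3,4) bound[OF tab, of fst] by (intro less.IH[OF _ tab]) simp
      moreover have "polytabloid \<alpha> T = (\<lambda>Y. - 1 * polytabloid \<alpha> (perm_tableau \<alpha> \<tau> T) Y)"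
        using polytabloid_column_perm[OF \<tau>(1)] \<tau>(2) by (simp add: fun_eq_iff)
      ultimately show ?thesis using scale by metis
    next
      case inc: True
      show ?thesis
      proof (cases "T \<in> standard_tableaux \<alpha>")
        case True
        then show ?thesis by (intro complex_fun.span_base) auto
      next
        case False
        then obtain i j j' where j: "j < j'" "(i, j') \<in> diagram \<alpha>" "\<not> T (i, j) < T (i, j')"
          using T inc unfolding standard_tableaux_def column_increasing_def by blast
        have "T (i, j) \<noteq> T (i, j')"
          using tableau_inj[OF T diagram_down[OF \<alpha> j(2)] j(2), of i j] j(1) by auto
        then have desc: "T (i, j') < T (i, j)" using j(3) by simp
        obtain X where X: "finite X" "\<And>\<sigma>. \<sigma> permutes X \<Longrightarrow> \<sigma> permutes {1..weight \<alpha>}"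
          "\<And>Y. (\<Sum>\<sigma> | \<sigma> permutes X. of_int (sign \<sigma>) * polytabloid \<alpha> (perm_tableau \<alpha> \<sigma> T) Y) = 0"
          "\<And>\<sigma>. \<sigma> permutes X \<Longrightarrow> \<sigma> \<notin> column_stabilizer \<alpha> T \<Longrightarrow>
            potential snd \<alpha> T < potential snd \<alpha> (perm_tableau \<alpha> \<sigma> T)"
          using garnir[OF \<alpha> T inc j(1,2) desc] by blast
        define G where "G = {\<sigma>. \<sigma> permutes X}"
        \<comment> \<open>Each term of the relation indexed by \<open>H\<close> equals the
          polytabloid of \<open>T\<close>, because the two signs cancel. The relation can be solved
          for it after division by \<open>card H\<close>, which is nonzero since \<open>H\<close>
          contains the identity.\<close>
        define H where "H = G \<inter> column_stabilizer \<alpha> T"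
        have "H \<subseteq> G" by (simp add: H_def)
        have fin: "finite G" unfolding G_def using X(1) by (rule finite_permutations)
        have "id \<in> H" by (simp add: H_def G_def column_stabilizer_def permutes_id)
        then have H: "card H \<noteq> 0" using fin by (auto simp: H_def)
        have rest: "polytabloid \<alpha> (perm_tableau \<alpha> \<sigma> T) \<in> ?V" if "\<sigma> \<in> G - H" for \<sigma>
        proof -
          have \<sigma>: "\<sigma> permutes X" "\<sigma> \<notin> column_stabilizer \<alpha> T" using that by (auto simp: G_def H_def)
          note tab = perm_tableau_in[OF T X(2)[OF \<sigma>(1)]]
          have "M snd - potential snd \<alpha> (perm_tableau \<alpha> \<sigma> T) < M snd - potential snd \<alpha> T"
            using X(4)[OF \<sigma>] bound[OF tab, of snd] by linarith
          then show ?thesis by (intro less.IH[OF _ tab]) simp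
        qed
        have eq: "polytabloid \<alpha> T Y = (\<Sum>\<sigma>\<in>G - H.
            - of_int (sign \<sigma>) / of_nat (card H) * polytabloid \<alpha> (perm_tableau \<alpha> \<sigma> T) Y)" for Y
        proof -
          have "(\<Sum>\<sigma>\<in>H. of_int (sign \<sigma>) * polytabloid \<alpha> (perm_tableau \<alpha> \<sigma> T) Y)
            = (\<Sum>\<sigma>\<in>H. polytabloid \<alpha> T Y)"
          proof (rule sum.cong[OF refl])
            fix \<sigma> assume "\<sigma> \<in> H"
            then have "polytabloid \<alpha> (perm_tableau \<alpha> \<sigma> T) Y = of_int (sign \<sigma>) * polytabloid \<alpha> T Y"
              by (intro polytabloid_column_perm) (simp add: H_def)
            then show "of_int (sign \<sigma>) * polytabloid \<alpha> (perm_tableau \<alpha> \<sigma> T) Y = polytabloid \<alpha> T Y"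
              by (simp add: mult.assoc[symmetric] flip: of_int_mult)
          qed
          moreover have "(\<Sum>\<sigma>\<in>G. of_int (sign \<sigma>) * polytabloid \<alpha> (perm_tableau \<alpha> \<sigma> T) Y) = 0"
            unfolding G_def by (rule X(3))
          ultimately have "(\<Sum>\<sigma>\<in>G - H. of_int (sign \<sigma>) * polytabloid \<alpha> (perm_tableau \<alpha> \<sigma> T) Y)
            = - (of_nat (card H) * polytabloid \<alpha> T Y)"
            using sum.subset_diff[of H G "\<lambda>\<sigma>. of_int (sign \<sigma>) * polytabloid \<alpha> (perm_tableau \<alpha> \<sigma> T) Y"]
              fin \<open>H \<subseteq> G\<close> by (simp add: eq_neg_iff_add_eq_0)
          then have "of_nat (card H) * polytabloid \<alpha> T Y
            = (\<Sum>\<sigma>\<in>G - H. - (of_int (sign \<sigma>) * polytabloid \<alpha> (perm_tableau \<alpha> \<sigma> T) Y))"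
            by (simp add: sum_negf)
          then have "polytabloid \<alpha> T Y
            = (\<Sum>\<sigma>\<in>G - H. - (of_int (sign \<sigma>) * polytabloid \<alpha> (perm_tableau \<alpha> \<sigma> T) Y)) / of_nat (card H)"
            using H by (simp add: field_simps)
          then show ?thesis by (simp add: sum_divide_distrib)
        qed
        have "polytabloid \<alpha> T = (\<Sum>\<sigma>\<in>G - H.
            (\<lambda>Y. - of_int (sign \<sigma>) / of_nat (card H) * polytabloid \<alpha> (perm_tableau \<alpha> \<sigma> T) Y))"
          by (rule ext) (simp only: sum_fun_apply eq[symmetric])
        also have "\<dots> \<in> ?V" using rest by (intro complex_fun.span_sum scale)
        finally show ?thesis .
      qed
    qed
  qed
qed

text \<open>Independence counts the set of standard polytabloids; injectivity is what turns this
  into a count of tableaux.\<close>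

lemma dim_V_eq_num_SYT:
  assumes \<alpha>: "is_partition \<alpha>"
  shows "dim_V \<alpha> = num_SYT \<alpha>"
proof -
  let ?B = "polytabloid \<alpha> ` standard_tableaux \<alpha>"
  have "complex_fun.span (polytabloid \<alpha> ` tableaux \<alpha>) \<subseteq> complex_fun.span ?B"
    using polytabloid_in_span[OF \<alpha>] by (intro complex_fun.span_minimal) auto
  moreover have "?B \<subseteq> complex_fun.span (polytabloid \<alpha> ` tableaux \<alpha>)"
    using standard_subset by (auto intro!: complex_fun.span_base)
  ultimately have "card ?B = dim_V \<alpha>"
    unfolding dim_V_def specht_module_def
    by (intro complex_fun.basis_card_eq_dim independent_polytabloids[OF \<alpha>])
  then show ?thesis
    using card_image[OF inj_on_polytabloid[OF \<alpha>]] by (simp add: num_SYT_def)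
qed

subsection \<open>Padded partitions\<close>

lemma
  assumes "is_partition lam" "weight lam + lam 0 \<le> d"
  shows is_partition_padded: "is_partition (padded lam d)"
    and weight_padded: "weight (padded lam d) = d"
proof -
  obtain n where n: "\<forall>i\<ge>n. lam i = 0" using partition_bound[OF assms(1)] .
  \<comment> \<open>The bound on \<open>d\<close> makes the new first part at least
    \<open>lam 0\<close>, hence at least every old part.\<close>
  have "lam k \<le> d - weight lam" for k
    using partitionD[OF assms(1), of 0 k] assms(2) by linarith
  then have "padded lam d j \<le> padded lam d i" if "i \<le> j" for i j
    using that partitionD[OF assms(1)] by (simp add: padded_def split: nat.split)
  moreover have zero: "\<forall>i\<ge>Suc n. padded lam d i = 0"
    using n by (auto simp: padded_def split: nat.splits)
  then have "finite {i. padded lam d i \<noteq> 0}"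
    by (auto intro!: finite_subset[of _ "{..<Suc n}"] simp: not_less[symmetric])
  ultimately show "is_partition (padded lam d)" by (auto simp: is_partition_def antimono_def)
  show "weight (padded lam d) = d"
    unfolding weight_eq_sum[OF zero] sum.lessThan_Suc_shift
    using weight_eq_sum[OF n] assms(2) by (simp add: padded_def)
qed

theorem theorem5p3:
  fixes lam mu :: "nat \<Rightarrow> nat" and d :: nat
  assumes "is_partition lam" and "is_partition mu"
    and "\<forall>i. even (lam i + mu i)"
    and "d \<ge> max (weight lam + lam 0) (weight mu + mu 0)"
  shows "(dim_V (padded (half_sum lam mu) d))\<^sup>2 \<ge> dim_V (padded lam d) * dim_V (padded mu d)
       \<and> (num_SYT (padded (half_sum lam mu) d))\<^sup>2 \<ge> num_SYT (padded lam d) * num_SYT (padded mu d)"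
proof -
  let ?nu = "half_sum lam mu"
  have d: "weight lam + lam 0 \<le> d" "weight mu + mu 0 \<le> d" using assms(4) by simp_all
  have half: "2 * ?nu i = lam i + mu i" for i using assms(3) by (simp add: half_sum_def)
  have nu: "is_partition ?nu" using is_partition_midpoint[OF assms(1,2) half] .
  have w: "2 * weight ?nu = weight lam + weight mu" using weight_midpoint[OF assms(1,2) half] .
  \<comment> \<open>The left side is the average of the corresponding quantities for
    \<open>lam\<close> and \<open>mu\<close>.\<close>
  have "weight ?nu + ?nu 0 \<le> d" using d half[of 0] w by linarith
  note P = is_partition_padded[OF assms(1) d(1)] weight_padded[OF assms(1) d(1)]
    is_partition_padded[OF assms(2) d(2)] weight_padded[OF assms(2) d(2)]
    is_partition_padded[OF nu this] weight_padded[OF nu this]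
  \<comment> \<open>At index 0 this uses that the sizes average too and that none of the
    subtractions from \<open>d\<close> truncates.\<close>
  have mid: "2 * padded ?nu d i = padded lam d i + padded mu d i" for i
    using half w d by (cases i) (auto simp: padded_def)
  have "num_SYT (padded lam d) * num_SYT (padded mu d) \<le> (num_SYT (padded ?nu d))\<^sup>2"
    using num_SYT_midpoint[OF P(1,3) mid] P by simp
  then show ?thesis by (simp add: dim_V_eq_num_SYT P)
qed

end
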